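(* Let $2<p\le3$ and $s>-(1-2/p)$. Then the Cauchy problem $iu_t+u_{xx}+|u|^2u=0$, $u|_{t=0}=\phi$, is not locally well posed from $L^p$ to $H^{s,p}$, in the sense that the following assertion is false: "for any $M>0$, (1) $\mathcal{S}_M\phi\in C([0,T_M];H^{s,p}(\mathbb{R}))$ for every $\phi\in\mathscr{B}^p_M$, and (2) there exists $C_M>0$ such that $$\sup_{t\in[0,T_M]}\|\mathcal{S}_M\phi_1-\mathcal{S}_M\phi_2\|_{H^{s,p}(\mathbb{R})}\le C_M\|\phi_1-\phi_2\|_{L^p}$$ for any $\phi_1,\phi_2\in\mathscr{B}^p_M$."
   Context: $H^{s,p}(\mathbb{R})$ is the Bessel potential space. $\mathscr{B}^p_M=\{\phi\in L^p(\mathbb{R})\mid\|\phi\|_{L^p}\le M\}$. $U(t)=e^{it\partial_x^2}$ denotes the free Schrödinger group on $\mathbb{R}$ (acting on tempered distributions). A solution of the Cauchy problem is understood as a solution of the integral equation $u(t)=U(t)\phi+i\int_0^tU(t-s)|u(s)|^2u(s)\,ds$, equivalently, with $v(t)=U(-t)u(t)$, of $v(t)=\phi+i\int_0^tU(-s)\big[|U(s)v(s)|^2\,U(s)v(s)\big]ds$. For $T>0$, $1\le p,q<\infty$, $\theta\in\mathbb{R}$: $\tilde X^p_{q,\theta}(T)$ is the space of $v:[0,T]\times\mathbb{R}\to\mathbb{C}$ with $\|v\|_{\tilde X^p_{q,\theta}(T)}=\big(\int_0^T(s^\theta\|(\partial_sv)(s,\cdot)\|_{L^p})^q\,ds\big)^{1/q}<\infty$;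 $X^p_{q,\theta}(T)=\{v\in\tilde X^p_{q,\theta}(T)\mid v(0)\in L^p\}$ with norm $\|v(0)\|_{L^p}+\|v\|_{\tilde X^p_{q,\theta}(T)}$; and $Y^p_{q,\theta}(T)$ consists of $u:[0,T]\times\mathbb{R}\to\mathbb{C}$ such that $U(-t)u(t)\in X^p_{q,\theta}(T)$, with norm $\|u\|_{Y^p_{q,\theta}(T)}=\|U(-t)u(t)\|_{X^p_{q,\theta}(T)}$. Throughout $q=p'=\frac{p}{p-1}$ and $\theta=-(1-\frac2p)$. For $2\le p<4$ and $M>0$, $T_M>0$ is the local existence time from the well-posedness result of the paper: for every $\phi\in\mathscr{B}^p_M$ there is a unique solution in $Y^p_{q,\theta}(T_M)$, denoted $\mathcal{S}_M\phi$, and $\phi\mapsto\mathcal{S}_M\phi$ is Lipschitz from $\mathscr{B}^p_M$ to $Y^p_{q,\theta}(T_M)$. *)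

theory Defs
  imports "HOL-Analysis.Analysis"
begin

section \<open>Lebesgue spaces on the line\<close>

text \<open>Elements of \<open>L\<^sup>p\<close> are Borel representatives; nothing below depends on the choice of
  the representative.\<close>

definition Lp :: "real \<Rightarrow> (real \<Rightarrow> complex) set" where
  "Lp p = {g \<in> borel_measurable borel. integrable lborel (\<lambda>x. norm (g x) powr p)}"

definition Lp_norm :: "real \<Rightarrow> (real \<Rightarrow> complex) \<Rightarrow> real" where
  "Lp_norm p g = (LINT x|lborel. norm (g x) powr p) powr (1 / p)"

definition Lp_ball :: "real \<Rightarrow> real \<Rightarrow> (real \<Rightarrow> complex) set" where
  "Lp_ball p M = {\<phi> \<in> Lp p. Lp_norm p \<phi> \<le> M}"

section \<open>Schwartz functions and tempered distributions\<close>

definition nderiv :: "nat \<Rightarrow> (real \<Rightarrow> complex) \<Rightarrow> real \<Rightarrow> complex" where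
  "nderiv n f = ((\<lambda>g x. vector_derivative g (at x)) ^^ n) f"

definition schwartz :: "(real \<Rightarrow> complex) set" where
  "schwartz = {f. (\<forall>n x. nderiv n f differentiable (at x)) \<and>
     (\<forall>j k. bounded (range (\<lambda>x. x ^ j *\<^sub>R nderiv k f x)))}"

definition schwartz_seminorm :: "nat \<Rightarrow> nat \<Rightarrow> (real \<Rightarrow> complex) \<Rightarrow> real" where
  "schwartz_seminorm j k f = (SUP x. norm (x ^ j *\<^sub>R nderiv k f x))"

text \<open>Functionals are extended by \<open>0\<close> off the Schwartz space, so that equality of tempered
  distributions is equality of functions.\<close>

type_synonym distr = "(real \<Rightarrow> complex) \<Rightarrow> complex"

definition tempered :: "distr set" where
  "tempered = {\<Lambda>. (\<forall>f. f \<notin> schwartz \<longrightarrow> \<Lambda> f = 0) \<and>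
     (\<forall>f\<in>schwartz. \<forall>g\<in>schwartz. \<forall>c. \<Lambda> (\<lambda>x. c * f x + g x) = c * \<Lambda> f + \<Lambda> g) \<and>
     (\<exists>C N. \<forall>f\<in>schwartz.
        norm (\<Lambda> f) \<le> C * (\<Sum>j\<le>N. \<Sum>k\<le>N. schwartz_seminorm j k f))}"

definition distr_diff :: "distr \<Rightarrow> distr \<Rightarrow> distr" where
  "distr_diff \<Lambda>1 \<Lambda>2 = (\<lambda>f. \<Lambda>1 f - \<Lambda>2 f)"

text \<open>Functions that define a tempered distribution by an absolutely convergent integral
  (continuity of the functional is then automatic, by the closed graph theorem).\<close>

definition regular_fun :: "(real \<Rightarrow> complex) \<Rightarrow> bool" where
  "regular_fun g \<longleftrightarrow> g \<in> borel_measurable borel \<and>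
     (\<forall>f\<in>schwartz. integrable lborel (\<lambda>x. g x * f x))"

definition distr_of :: "(real \<Rightarrow> complex) \<Rightarrow> distr" where
  "distr_of g = (\<lambda>f. if f \<in> schwartz then LINT x|lborel. g x * f x else 0)"

definition regular_distr :: "distr set" where
  "regular_distr = distr_of ` Collect regular_fun"

text \<open>The function underlying a regular distribution; it is unique almost everywhere.\<close>

definition density_of :: "distr \<Rightarrow> real \<Rightarrow> complex" where
  "density_of \<Lambda> = (SOME g. regular_fun g \<and> distr_of g = \<Lambda>)"

section \<open>Fourier multipliers\<close>

definition fourier :: "(real \<Rightarrow> complex) \<Rightarrow> real \<Rightarrow> complex" where
  "fourier f \<xi> = (LINT x|lborel. exp (- \<i> * of_real (x * \<xi>)) * f x)"

definition inv_fourier :: "(real \<Rightarrow> complex) \<Rightarrow> real \<Rightarrow> complex" where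
  "inv_fourier f x = (LINT \<xi>|lborel. exp (\<i> * of_real (x * \<xi>)) * f \<xi>) / of_real (2 * pi)"

definition fourier_distr :: "distr \<Rightarrow> distr" where
  "fourier_distr \<Lambda> = (\<lambda>f. if f \<in> schwartz then \<Lambda> (fourier f) else 0)"

definition inv_fourier_distr :: "distr \<Rightarrow> distr" where
  "inv_fourier_distr \<Lambda> = (\<lambda>f. if f \<in> schwartz then \<Lambda> (inv_fourier f) else 0)"

definition mult_distr :: "(real \<Rightarrow> complex) \<Rightarrow> distr \<Rightarrow> distr" where
  "mult_distr m \<Lambda> = (\<lambda>f. if f \<in> schwartz then \<Lambda> (\<lambda>\<xi>. m \<xi> * f \<xi>) else 0)"

definition fourier_multiplier :: "(real \<Rightarrow> complex) \<Rightarrow> distr \<Rightarrow> distr" where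
  "fourier_multiplier m \<Lambda> = inv_fourier_distr (mult_distr m (fourier_distr \<Lambda>))"

text \<open>\<open>e\<^bsup>it\<partial>\<^sub>x\<^sup>2\<^esup>\<close> has symbol \<open>e\<^bsup>-it\<xi>\<^sup>2\<^esup>\<close>, and \<open>(1 - \<partial>\<^sub>x\<^sup>2)\<^bsup>s/2\<^esup>\<close> has symbol \<open>(1 + \<xi>\<^sup>2)\<^bsup>s/2\<^esup>\<close>.\<close>

definition schrodinger_group :: "real \<Rightarrow> distr \<Rightarrow> distr" where
  "schrodinger_group t = fourier_multiplier (\<lambda>\<xi>. exp (- \<i> * of_real (t * \<xi>\<^sup>2)))"

definition bessel_potential :: "real \<Rightarrow> distr \<Rightarrow> distr" where
  "bessel_potential s = fourier_multiplier (\<lambda>\<xi>. of_real ((1 + \<xi>\<^sup>2) powr (s / 2)))"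

definition bessel_space :: "real \<Rightarrow> real \<Rightarrow> distr set" where
  "bessel_space s p = {\<Lambda> \<in> tempered. bessel_potential s \<Lambda> \<in> distr_of ` Lp p}"

definition bessel_norm :: "real \<Rightarrow> real \<Rightarrow> distr \<Rightarrow> real" where
  "bessel_norm s p \<Lambda> = Lp_norm p (density_of (bessel_potential s \<Lambda>))"

definition bessel_continuous :: "real \<Rightarrow> real \<Rightarrow> real \<Rightarrow> (real \<Rightarrow> distr) set" where
  "bessel_continuous s p T = {u. (\<forall>t\<in>{0..T}. u t \<in> bessel_space s p) \<and>
     (\<forall>t0\<in>{0..T}.
        ((\<lambda>t. bessel_norm s p (distr_diff (u t) (u t0))) \<longlongrightarrow> 0) (at t0 within {0..T}))}"

section \<open>The spaces \<open>X\<close> and \<open>Y\<close>\<close>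

text \<open>The time derivative is the weak one: \<open>v\<close> is absolutely continuous in time up to \<open>t = 0\<close>
  (so that \<open>v 0\<close> is its initial value) and \<open>w = \<partial>\<^sub>s v\<close> is determined almost everywhere.\<close>

definition has_time_derivative ::
    "real \<Rightarrow> (real \<Rightarrow> real \<Rightarrow> complex) \<Rightarrow> (real \<Rightarrow> real \<Rightarrow> complex) \<Rightarrow> bool" where
  "has_time_derivative T v w \<longleftrightarrow>
     (\<lambda>(s, x). w s x) \<in> borel_measurable (borel \<Otimes>\<^sub>M borel) \<and>
     (\<forall>t\<in>{0..T}. AE x in lborel. set_integrable lborel {0..t} (\<lambda>s. w s x) \<and>
        v t x = v 0 x + (LINT s:{0..t}|lborel. w s x))"

definition time_deriv ::
    "real \<Rightarrow> (real \<Rightarrow> real \<Rightarrow> complex) \<Rightarrow> real \<Rightarrow> real \<Rightarrow> complex" where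
  "time_deriv T v = (SOME w. has_time_derivative T v w)"

definition Xt_space ::
    "real \<Rightarrow> real \<Rightarrow> real \<Rightarrow> real \<Rightarrow> (real \<Rightarrow> real \<Rightarrow> complex) set" where
  "Xt_space p q \<theta> T = {v. (\<forall>t\<in>{0..T}. v t \<in> borel_measurable borel) \<and>
     (\<exists>w. has_time_derivative T v w) \<and>
     (AE s in lborel. s \<in> {0..T} \<longrightarrow> time_deriv T v s \<in> Lp p) \<and>
     set_integrable lborel {0..T} (\<lambda>s. (s powr \<theta> * Lp_norm p (time_deriv T v s)) powr q)}"

definition Xt_norm ::
    "real \<Rightarrow> real \<Rightarrow> real \<Rightarrow> real \<Rightarrow> (real \<Rightarrow> real \<Rightarrow> complex) \<Rightarrow> real" where
  "Xt_norm p q \<theta> T v =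
     (LINT s:{0..T}|lborel. (s powr \<theta> * Lp_norm p (time_deriv T v s)) powr q) powr (1 / q)"

definition X_space ::
    "real \<Rightarrow> real \<Rightarrow> real \<Rightarrow> real \<Rightarrow> (real \<Rightarrow> real \<Rightarrow> complex) set" where
  "X_space p q \<theta> T = {v \<in> Xt_space p q \<theta> T. v 0 \<in> Lp p}"

definition X_norm ::
    "real \<Rightarrow> real \<Rightarrow> real \<Rightarrow> real \<Rightarrow> (real \<Rightarrow> real \<Rightarrow> complex) \<Rightarrow> real" where
  "X_norm p q \<theta> T v = Lp_norm p (v 0) + Xt_norm p q \<theta> T v"

text \<open>\<open>u t\<close> is in general only a distribution, but \<open>U(-t) u(t)\<close> is required to be a function.\<close>

definition profile :: "(real \<Rightarrow> distr) \<Rightarrow> real \<Rightarrow> real \<Rightarrow> complex" where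
  "profile u t = density_of (schrodinger_group (- t) (u t))"

definition Y_space :: "real \<Rightarrow> real \<Rightarrow> real \<Rightarrow> real \<Rightarrow> (real \<Rightarrow> distr) set" where
  "Y_space p q \<theta> T = {u.
     (\<forall>t\<in>{0..T}. u t \<in> tempered \<and> schrodinger_group (- t) (u t) \<in> regular_distr) \<and>
     profile u \<in> X_space p q \<theta> T}"

definition Y_norm :: "real \<Rightarrow> real \<Rightarrow> real \<Rightarrow> real \<Rightarrow> (real \<Rightarrow> distr) \<Rightarrow> real" where
  "Y_norm p q \<theta> T u = X_norm p q \<theta> T (profile u)"

section \<open>The cubic equation\<close>

text \<open>\<open>|u|\<^sup>2u\<close> makes sense when \<open>u\<close> is a function whose cube is again a tempered
  distribution. For \<open>u\<close> in the space \<open>Y\<close> this is only available for almost every time.\<close>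

definition cube :: "(real \<Rightarrow> complex) \<Rightarrow> real \<Rightarrow> complex" where
  "cube g x = of_real ((norm (g x))\<^sup>2) * g x"

definition cubic_defined :: "distr \<Rightarrow> bool" where
  "cubic_defined \<Lambda> \<longleftrightarrow> \<Lambda> \<in> regular_distr \<and> regular_fun (cube (density_of \<Lambda>))"

definition cubic :: "distr \<Rightarrow> distr" where
  "cubic \<Lambda> = distr_of (cube (density_of \<Lambda>))"

text \<open>The Duhamel integral is a weak integral in the space of tempered distributions.\<close>

definition nls_solution :: "real \<Rightarrow> (real \<Rightarrow> complex) \<Rightarrow> (real \<Rightarrow> distr) \<Rightarrow> bool" where
  "nls_solution T \<phi> u \<longleftrightarrow>
     (AE s in lebesgue. s \<in> {0..T} \<longrightarrow> cubic_defined (u s)) \<and>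
     (\<forall>t\<in>{0..T}. \<forall>f\<in>schwartz.
        set_integrable lebesgue {0..t} (\<lambda>s. schrodinger_group (t - s) (cubic (u s)) f) \<and>
        u t f = schrodinger_group t (distr_of \<phi>) f
          + \<i> * (LINT s:{0..t}|lebesgue. schrodinger_group (t - s) (cubic (u s)) f))"

text \<open>\<open>S\<close> is the (unique, Lipschitz) solution map on the ball of radius \<open>M\<close>, with existence
  time \<open>T\<close>, in the space \<open>Y\<close> with \<open>q = p/(p - 1)\<close> and \<open>\<theta> = -(1 - 2/p)\<close>.\<close>

definition lwp_solution_map ::
    "real \<Rightarrow> real \<Rightarrow> real \<Rightarrow> ((real \<Rightarrow> complex) \<Rightarrow> real \<Rightarrow> distr) \<Rightarrow> bool" where
  "lwp_solution_map p M T S \<longleftrightarrow>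
     (let q = p / (p - 1); \<theta> = - (1 - 2 / p) in
       T > 0 \<and>
       (\<forall>\<phi>\<in>Lp_ball p M.
          S \<phi> \<in> Y_space p q \<theta> T \<and> nls_solution T \<phi> (S \<phi>) \<and>
          (\<forall>u\<in>Y_space p q \<theta> T. nls_solution T \<phi> u \<longrightarrow> (\<forall>t\<in>{0..T}. u t = S \<phi> t))) \<and>
       (\<exists>L. \<forall>\<phi>1\<in>Lp_ball p M. \<forall>\<phi>2\<in>Lp_ball p M.
          Y_norm p q \<theta> T (\<lambda>t. distr_diff (S \<phi>1 t) (S \<phi>2 t))
            \<le> L * Lp_norm p (\<lambda>x. \<phi>1 x - \<phi>2 x)))"

end

(* Only the linear part of the equation matters. The solution with data 0 is 0, so both Lipschitz
   bounds, tested against it, are bounds for S phi itself. The Y-bound says that the profile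
   v(t) = U(-t)u(t) satisfies |v(t) - phi|_p <= L t^(1-1/p) |phi|_p, and the H^(s,p)-bound controls
   the pairing of v(t) with k = U(t)<d_x>^s f by C |phi|_p |f|_p'. Taking for phi the function dual
   to k and a small fixed time t gives |U(t)<d_x>^s f|_p' <= 2C |f|_p' for all Schwartz f. This fails
   for Gaussians of width sqrt a as a -> 0: pairing with a chirp that focuses at time t shows that
   the ratio of the two sides is at least of order a^(-(s + 1 - 2/p)/2). *)

theory Submission
  imports Defs "HOL-Probability.Probability"
begin

text \<open>Densities of distributions and time derivatives are picked by \<open>SOME\<close>, so
  they are fixed only almost everywhere, and v(t) is not known to lie in L^p. Hence every estimate
  is made on pairings with Schwartz functions, and much of the work goes into showing that a regular
  distribution determines its density, and that the zero function really qualifies as a solution in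
  \<open>Y_space\<close>. Multipliers act by duality: tested on \<open>fourier F\<close> they just
  multiply \<open>F\<close>, once \<open>inv_fourier (fourier F) = F\<close> is known. This is why
  the test functions below are given as Fourier transforms. The threshold for s comes from three
  powers of a. The chirp has L^p norm of order a^(-1/(2p)), because it spreads over a length
  a^(-1/2). The transform of the Gaussian of parameter a has L^p' norm of order a^(-1/2+1/(2p')) =
  a^(-1/(2p)). The overlap of chirp and evolved Gaussian, computed over frequencies of size
  a^(-1/2), has order a^(-s/2-1/2). The overlap dominates the product of the two norms, as a tends
  to 0, when s/2 + 1/2 > 1/p.\<close>

section \<open>Schwartz functions\<close>

text \<open>If the bounded functions of \<open>K\<close> are stable under d/dx and under
  multiplication by x, all x^j f^(k) stay in \<open>K\<close>. Each membership proof below reduces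
  to guessing a stable class, without formulas for higher derivatives.\<close>

lemma schwartz_coinduct:
  fixes f :: "real \<Rightarrow> complex"
  assumes "f \<in> K"
    and bdd: "\<And>g. g \<in> K \<Longrightarrow> bounded (range g)"
    and mult: "\<And>g. g \<in> K \<Longrightarrow> (\<lambda>x. of_real x * g x) \<in> K"
    and deriv: "\<And>g. g \<in> K \<Longrightarrow> \<exists>g'\<in>K. \<forall>x. (g has_vector_derivative g' x) (at x)"
  shows "f \<in> schwartz"
proof -
  have nd: "nderiv n f \<in> K" for n
  proof (induction n)
    case 0
    show ?case using assms(1) by (simp add: nderiv_def)
  next
    case (Suc n)
    from deriv[OF Suc] obtain g' where g': "g' \<in> K"
      "\<forall>x. (nderiv n f has_vector_derivative g' x) (at x)" by blast
    have "nderiv (Suc n) f = g'"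
      using g'(2) by (auto simp: nderiv_def fun_eq_iff vector_derivative_at)
    with g'(1) show ?case by simp
  qed
  have "nderiv n f differentiable (at x)" for n x
    using deriv[OF nd[of n]] by (meson differentiableI_vector)
  moreover have "(\<lambda>x. x ^ j *\<^sub>R g x) \<in> K" if "g \<in> K" for j g
  proof (induction j)
    case (Suc j)
    have "(\<lambda>x. x ^ Suc j *\<^sub>R g x) = (\<lambda>x. of_real x * (x ^ j *\<^sub>R g x))"
      by (auto simp: scaleR_conv_of_real)
    with mult[OF Suc] show ?case by simp
  qed (use that in simp)
  ultimately show ?thesis
    unfolding schwartz_def using nd bdd by blast
qed

lemma schwartz_has_vector_derivative:
  assumes "f \<in> schwartz"
  shows "(nderiv n f has_vector_derivative nderiv (Suc n) f x) (at x)"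
  using assms by (auto simp: schwartz_def nderiv_def vector_derivative_works[symmetric])

lemma nderiv_0 [simp]: "nderiv 0 f = f"
  by (simp add: nderiv_def)

lemma nderiv_nderiv: "nderiv m (nderiv n f) = nderiv (m + n) f"
  by (simp add: nderiv_def funpow_add)

lemma schwartz_nderiv:
  assumes "f \<in> schwartz" shows "nderiv n f \<in> schwartz"
  using assms by (auto simp: schwartz_def nderiv_nderiv)

lemma schwartz_bounded:
  assumes "f \<in> schwartz"
  shows "\<exists>C>0. \<forall>x. norm (x ^ j *\<^sub>R nderiv k f x) \<le> C"
proof -
  have "bounded (range (\<lambda>x. x ^ j *\<^sub>R nderiv k f x))"
    using assms by (auto simp: schwartz_def)
  then obtain C where "C > 0" "\<forall>y\<in>range (\<lambda>x. x ^ j *\<^sub>R nderiv k f x). norm y \<le> C"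
    by (auto simp: bounded_pos)
  then show ?thesis by auto
qed

text \<open>The stable class consists of the combinations of derivatives of f with polynomial
  coefficients; the product rule does not leave it.\<close>

lemma schwartz_mult_x:
  assumes f: "f \<in> schwartz"
  shows "(\<lambda>x. of_real x * f x) \<in> schwartz"
proof (rule schwartz_coinduct)
  let ?K = "{g. \<exists>n. \<exists>P :: nat \<Rightarrow> complex poly. g = (\<lambda>x. \<Sum>k<n. poly (P k) (of_real x) * nderiv k f x)}"
  show "(\<lambda>x. of_real x * f x) \<in> ?K"
    by (rule CollectI, rule exI[of _ 1], rule exI[of _ "\<lambda>_. [:0, 1:]"]) simp
  show "(\<lambda>x. of_real x * g x) \<in> ?K" if g: "g \<in> ?K" for g
  proof -
    from g obtain n P where g: "g = (\<lambda>x. \<Sum>k<n. poly (P k) (of_real x) * nderiv k f x)" by auto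
    show ?thesis
      by (rule CollectI, rule exI[of _ n], rule exI[of _ "\<lambda>k. pCons 0 (P k)"])
        (simp add: g sum_distrib_left mult.assoc)
  qed
  show "\<exists>g'\<in>?K. \<forall>x. (g has_vector_derivative g' x) (at x)" if g: "g \<in> ?K" for g
  proof -
    from g obtain n P where g: "g = (\<lambda>x. \<Sum>k<n. poly (P k) (of_real x) * nderiv k f x)" by auto
    \<comment> \<open>The coefficient of f^(k) in the derivative: P_k' from differentiating the
      coefficient, and P_(k-1) from differentiating f^(k-1).\<close>
    define Q where "Q k = (if k < n then pderiv (P k) else 0) + (if k = 0 then 0 else P (k - 1))" for k
    have pd: "((\<lambda>x. poly p (of_real x)) has_vector_derivative poly (pderiv p) (of_real x)) (at x)"
      for p :: "complex poly" and x :: real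
      using has_vector_derivative_real_field[OF poly_DERIV[of p "of_real x"]] by simp
    have "(g has_vector_derivative (\<Sum>k<n. poly (P k) (of_real x) * nderiv (Suc k) f x
        + poly (pderiv (P k)) (of_real x) * nderiv k f x)) (at x)" for x
      unfolding g by (intro has_vector_derivative_sum has_vector_derivative_mult pd
          schwartz_has_vector_derivative f)
    moreover have "(\<Sum>k<n. poly (P k) (of_real x) * nderiv (Suc k) f x
        + poly (pderiv (P k)) (of_real x) * nderiv k f x)
        = (\<Sum>k<Suc n. poly (Q k) (of_real x) * nderiv k f x)" for x
    proof -
      have "(\<Sum>k<Suc n. poly (Q k) (of_real x) * nderiv k f x) =
        (\<Sum>k<Suc n. poly (if k < n then pderiv (P k) else 0) (of_real x) * nderiv k f x)
        + (\<Sum>k<Suc n. poly (if k = 0 then 0 else P (k - 1)) (of_real x) * nderiv k f x)"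
        unfolding Q_def by (simp only: poly_add distrib_right sum.distrib)
      also have "(\<Sum>k<Suc n. poly (if k = 0 then 0 else P (k - 1)) (of_real x) * nderiv k f x)
        = (\<Sum>k<n. poly (P k) (of_real x) * nderiv (Suc k) f x)"
        by (subst sum.lessThan_Suc_shift) simp
      finally show ?thesis by (simp add: sum.distrib)
    qed
    ultimately have "\<forall>x. (g has_vector_derivative
        (\<lambda>x. \<Sum>k<Suc n. poly (Q k) (of_real x) * nderiv k f x) x) (at x)" by simp
    moreover have "(\<lambda>x. \<Sum>k<Suc n. poly (Q k) (of_real x) * nderiv k f x) \<in> ?K" by blast
    ultimately show ?thesis by (rule bexI)
  qed
  show "bounded (range g)" if g: "g \<in> ?K" for g
  proof -
    have *: "bounded (range (\<lambda>x. poly p (of_real x) * nderiv k f x))" for p k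
    proof -
      \<comment> \<open>Peeling a coefficient off the polynomial moves a factor x to the other side,
        so the induction must hold for all j at once.\<close>
      have "\<exists>C. \<forall>x. norm (poly p (of_real x) * (x ^ j *\<^sub>R nderiv k f x)) \<le> C" for j
      proof (induction p arbitrary: j)
        case 0
        show ?case by auto
      next
        case (pCons a p)
        obtain C where C: "\<And>x. norm (x ^ j *\<^sub>R nderiv k f x) \<le> C" using schwartz_bounded[OF f] by meson
        obtain D where D: "\<And>x. norm (poly p (of_real x) * (x ^ Suc j *\<^sub>R nderiv k f x)) \<le> D"
          using pCons.IH[of "Suc j"] by auto
        have "norm (poly (pCons a p) (of_real x) * (x ^ j *\<^sub>R nderiv k f x)) \<le> norm a * C + D" for x
        proof -
          have "poly (pCons a p) (of_real x) * (x ^ j *\<^sub>R nderiv k f x)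
             = a * (x ^ j *\<^sub>R nderiv k f x) + poly p (of_real x) * (x ^ Suc j *\<^sub>R nderiv k f x)"
            by (simp add: scaleR_conv_of_real algebra_simps)
          then show ?thesis
            using norm_triangle_mono[OF _ D[of x], of "a * (x ^ j *\<^sub>R nderiv k f x)" "norm a * C"]
              mult_left_mono[OF C[of x] norm_ge_zero[of a]] by (simp only: norm_mult)
        qed
        then show ?case by blast
      qed
      from this[of 0] show ?thesis by (auto simp: bounded_iff)
    qed
    from g obtain n P where g: "g = (\<lambda>x. \<Sum>k<n. poly (P k) (of_real x) * nderiv k f x)" by auto
    have "bounded (range (\<lambda>x. \<Sum>k<n. poly (P k) (of_real x) * nderiv k f x))"
    proof (induction n)
      case 0
      show ?case by (simp add: image_constant_conv)
    next
      case (Suc n)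
      then show ?case using bounded_plus_comp[OF Suc *] by simp
    qed
    then show ?thesis by (simp add: g)
  qed
qed

lemma schwartz_cmult:
  assumes f: "f \<in> schwartz" shows "(\<lambda>x. c * f x) \<in> schwartz"
proof (rule schwartz_coinduct)
  let ?K = "(\<lambda>g x. c * g x) ` schwartz"
  show "(\<lambda>x. c * f x) \<in> ?K" using f by blast
  show "bounded (range g)" if g: "g \<in> ?K" for g
  proof -
    from g obtain h where h: "h \<in> schwartz" "g = (\<lambda>x. c * h x)" by auto
    obtain C where C: "\<And>x. norm (x ^ 0 *\<^sub>R nderiv 0 h x) \<le> C" using schwartz_bounded[OF h(1)] by meson
    then have "norm (g x) \<le> norm c * C" for x
      by (auto simp: h(2) norm_mult intro!: mult_left_mono)
    then show ?thesis by (auto simp: bounded_iff)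
  qed
  show "(\<lambda>x. of_real x * g x) \<in> ?K" if g: "g \<in> ?K" for g
  proof -
    from g obtain h where h: "h \<in> schwartz" "g = (\<lambda>x. c * h x)" by auto
    have "(\<lambda>x. of_real x * g x) = (\<lambda>x. c * (of_real x * h x))" by (simp add: h(2) algebra_simps)
    with schwartz_mult_x[OF h(1)] show ?thesis by (intro image_eqI)
  qed
  show "\<exists>g'\<in>?K. \<forall>x. (g has_vector_derivative g' x) (at x)" if g: "g \<in> ?K" for g
  proof -
    from g obtain h where h: "h \<in> schwartz" "g = (\<lambda>x. c * h x)" by auto
    have "(g has_vector_derivative c * nderiv 1 h x) (at x)" for x
      using schwartz_has_vector_derivative[OF h(1), of 0 x] unfolding h(2)
      by (intro has_vector_derivative_mult_right) simp
    then show ?thesis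
      using schwartz_nderiv[OF h(1), of 1] by (intro bexI[of _ "\<lambda>x. c * nderiv 1 h x"]) auto
  qed
qed

lemma schwartz_continuous:
  assumes "f \<in> schwartz" shows "continuous_on A f"
  using schwartz_has_vector_derivative[OF assms, of 0]
  by (auto intro!: continuous_at_imp_continuous_on has_vector_derivative_continuous)

lemma schwartz_measurable [measurable_dest]:
  assumes "f \<in> schwartz" shows "f \<in> borel_measurable borel"
  by (intro borel_measurable_continuous_onI schwartz_continuous assms)

lemma schwartz_decay:
  assumes f: "f \<in> schwartz"
  shows "\<exists>C>0. \<forall>x. norm (f x) \<le> C / (1 + x\<^sup>2)"
proof -
  obtain C0 where C0: "C0 > 0" "\<And>x. norm (x ^ 0 *\<^sub>R nderiv 0 f x) \<le> C0" using schwartz_bounded[OF f] by meson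
  obtain C2 where C2: "C2 > 0" "\<And>x. norm (x ^ 2 *\<^sub>R nderiv 0 f x) \<le> C2" using schwartz_bounded[OF f] by meson
  have "norm (f x) \<le> (C0 + C2) / (1 + x\<^sup>2)" for x
    using C0(2)[of x] C2(2)[of x] by (simp add: field_simps add_pos_nonneg)
  with C0(1) C2(1) show ?thesis by (intro exI[of _ "C0 + C2"]) auto
qed

lemma integrable_inverse_1_plus_sq: "integrable lborel (\<lambda>x::real. 1 / (1 + x\<^sup>2))"
  using integrable_inverse_1_plus_square
  by (simp add: set_integrable_def einterval_def inverse_eq_divide)

lemma schwartz_powr_integrable:
  assumes f: "f \<in> schwartz" and q: "q \<ge> 1"
  shows "integrable lborel (\<lambda>x. norm (f x) powr q)"
proof -
  obtain C where C: "C > 0" "\<And>x. norm (f x) \<le> C / (1 + x\<^sup>2)" using schwartz_decay[OF f] by meson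
  note [measurable] = schwartz_measurable[OF f]
  show ?thesis
  proof (rule Bochner_Integration.integrable_bound)
    show "integrable lborel (\<lambda>x. C powr q * (1 / (1 + x\<^sup>2)))"
      by (intro integrable_mult_right integrable_inverse_1_plus_sq)
    show "AE x in lborel. norm (norm (f x) powr q) \<le> norm (C powr q * (1 / (1 + x\<^sup>2)))"
    proof (rule AE_I2)
      fix x :: real
      have "norm (f x) powr q \<le> (C / (1 + x\<^sup>2)) powr q"
        using C q by (intro powr_mono2) auto
      also have "\<dots> = C powr q / (1 + x\<^sup>2) powr q"
        using C by (simp add: powr_divide)
      also have "\<dots> \<le> C powr q / (1 + x\<^sup>2) powr 1"
        using q C by (intro divide_left_mono powr_mono mult_pos_pos) (auto simp: add_pos_nonneg add_nonneg_eq_0_iff)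
      finally show "norm (norm (f x) powr q) \<le> norm (C powr q * (1 / (1 + x\<^sup>2)))"
        by simp
    qed
  qed measurable
qed

lemma schwartz_integrable:
  assumes f: "f \<in> schwartz" shows "integrable lborel f"
proof -
  note [measurable] = schwartz_measurable[OF f]
  have "integrable lborel (\<lambda>x. norm (f x))"
    using schwartz_powr_integrable[OF f, of 1] by simp
  then show ?thesis by (rule integrable_norm_cancel) measurable
qed

lemma schwartz_Lp: "f \<in> schwartz \<Longrightarrow> q \<ge> 1 \<Longrightarrow> f \<in> Lp q"
  by (simp add: Lp_def schwartz_powr_integrable schwartz_measurable)

text \<open>One family, stable under d/dx and multiplication by x, that contains the Gaussians with
  complex parameter, their modulations by exp(itx), and their products with the Bessel symbol. The
  real exponent \<sigma> drops by one under d/dx and the polynomial makes up for it.\<close>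

definition gauss_weight :: "complex poly \<Rightarrow> real \<Rightarrow> complex \<Rightarrow> complex \<Rightarrow> real \<Rightarrow> complex" where
  "gauss_weight P \<sigma> b c x =
     poly P (of_real x) * of_real ((1 + x\<^sup>2) powr \<sigma>) * exp (c * of_real x - b * (of_real x)\<^sup>2)"

text \<open>For \<sigma> > 0 this is exp(u) \<ge> u at u = \<delta>y/\<sigma>, raised to the power
  \<sigma>; otherwise the left side is at most 1.\<close>

lemma powr_le_exp:
  fixes y \<sigma> \<delta> :: real
  assumes "\<delta> > 0"
  obtains C where "C > 0" "\<And>y. y \<ge> 1 \<Longrightarrow> y powr \<sigma> \<le> C * exp (\<delta> * y)"
proof (cases "\<sigma> > 0")
  case True
  have "y powr \<sigma> \<le> (\<sigma> / \<delta>) powr \<sigma> * exp (\<delta> * y)" if "y \<ge> 1" for y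
  proof -
    have "y * (\<delta> / \<sigma>) \<le> exp (\<delta> * y / \<sigma>)"
      using exp_ge_add_one_self[of "\<delta> * y / \<sigma>"] unfolding mult.commute[of y]
      by (simp only: times_divide_eq_left)
    then have "y \<le> (\<sigma> / \<delta>) * exp (\<delta> * y / \<sigma>)"
      using True assms by (simp add: field_simps)
    then have "y powr \<sigma> \<le> ((\<sigma> / \<delta>) * exp (\<delta> * y / \<sigma>)) powr \<sigma>"
      using True that by (intro powr_mono2) auto
    also have "\<dots> = (\<sigma> / \<delta>) powr \<sigma> * exp (\<delta> * y)"
      using True assms by (subst powr_mult) (simp_all add: exp_powr_real)
    finally show ?thesis .
  qed
  then show ?thesis using True assms by (intro that[of "(\<sigma> / \<delta>) powr \<sigma>"]) auto
next
  case False
  have "y powr \<sigma> \<le> 1 * exp (\<delta> * y)" if "y \<ge> 1" for y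
  proof -
    have "y powr \<sigma> \<le> y powr 0" using False that by (intro powr_mono) auto
    also have "\<dots> \<le> exp (\<delta> * y)" using that assms by simp
    finally show ?thesis by simp
  qed
  then show ?thesis by (intro that[of 1]) auto
qed

text \<open>Polynomial and Bessel weight together grow at most like a power of 1 + x^2. Half of the
  Gaussian decay absorbs that power, and the other half absorbs the linear exponent by completing
  the square.\<close>

lemma gauss_weight_bounded:
  assumes b: "Re b > 0"
  shows "bounded (range (gauss_weight P \<sigma> b c))"
proof -
  have "\<exists>C n. \<forall>x::real. norm (poly P (of_real x)) \<le> C * (1 + x\<^sup>2) ^ n \<and> C \<ge> 0"
  proof (induction P)
    case 0
    show ?case by (rule exI[of _ 0]) auto
  next
    case (pCons a P)
    then obtain C n where C: "\<And>x::real. norm (poly P (of_real x)) \<le> C * (1 + x\<^sup>2) ^ n" "C \<ge> 0" by auto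
    have "norm (poly (pCons a P) (of_real x)) \<le> (norm a + C) * (1 + x\<^sup>2) ^ Suc n" for x :: real
    proof -
      have x: "\<bar>x\<bar> \<le> 1 + x\<^sup>2"
      proof -
        have "0 \<le> (\<bar>x\<bar> - 1)\<^sup>2" by simp
        then show ?thesis unfolding power2_diff by simp
      qed
      have "norm (poly (pCons a P) (of_real x)) \<le> norm a + \<bar>x\<bar> * norm (poly P (of_real x))"
        by (simp add: norm_triangle_le norm_mult)
      also have "\<dots> \<le> norm a * (1 + x\<^sup>2) ^ Suc n + (1 + x\<^sup>2) * (C * (1 + x\<^sup>2) ^ n)"
        using C x by (intro add_mono mult_mono mult_le_cancel_left1[THEN iffD2])
          (auto intro!: one_le_power simp del: power_Suc)
      finally show ?thesis by (simp add: algebra_simps)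
    qed
    then show ?case using C(2) by (intro exI[of _ "norm a + C"] exI[of _ "Suc n"]) auto
  qed
  then obtain C n where C: "\<And>x::real. norm (poly P (of_real x)) \<le> C * (1 + x\<^sup>2) ^ n" "C \<ge> 0" by auto
  define \<beta> where "\<beta> = Re b"
  define \<gamma> where "\<gamma> = Re c"
  have \<beta>: "\<beta> > 0" using b by (simp add: \<beta>_def)
  obtain D where D: "D > 0" "\<And>y. y \<ge> 1 \<Longrightarrow> y powr (n + \<sigma>) \<le> D * exp (\<beta> / 2 * y)"
    by (rule powr_le_exp[of "\<beta> / 2" "n + \<sigma>"]) (use \<beta> in auto)
  have "norm (gauss_weight P \<sigma> b c x) \<le> C * D * exp (\<beta> / 2 + \<gamma>\<^sup>2 / (2 * \<beta>))" for x
  proof -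
    have "Re (b * (of_real x)\<^sup>2) = \<beta> * x\<^sup>2" by (simp add: \<beta>_def flip: of_real_power)
    then have n: "norm (gauss_weight P \<sigma> b c x) =
        norm (poly P (of_real x)) * (1 + x\<^sup>2) powr \<sigma> * exp (\<gamma> * x - \<beta> * x\<^sup>2)"
      by (simp add: gauss_weight_def norm_mult \<gamma>_def)
    have "0 \<le> (\<beta> * x - \<gamma>)\<^sup>2 / (2 * \<beta>)" using \<beta> by simp
    also have "(\<beta> * x - \<gamma>)\<^sup>2 / (2 * \<beta>) = \<beta> / 2 * x\<^sup>2 - \<gamma> * x + \<gamma>\<^sup>2 / (2 * \<beta>)"
      using \<beta> by (simp add: field_simps power2_eq_square)
    finally have e: "\<beta> / 2 * (1 + x\<^sup>2) + (\<gamma> * x - \<beta> * x\<^sup>2) \<le> \<beta> / 2 + \<gamma>\<^sup>2 / (2 * \<beta>)"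
      by (simp add: algebra_simps)
    have "norm (gauss_weight P \<sigma> b c x) \<le>
        (C * (1 + x\<^sup>2) ^ n) * (1 + x\<^sup>2) powr \<sigma> * exp (\<gamma> * x - \<beta> * x\<^sup>2)"
      unfolding n using C by (intro mult_right_mono) auto
    also have "\<dots> = C * ((1 + x\<^sup>2) powr (n + \<sigma>)) * exp (\<gamma> * x - \<beta> * x\<^sup>2)"
      by (simp add: powr_add powr_realpow add_pos_nonneg)
    also have "\<dots> \<le> C * (D * exp (\<beta> / 2 * (1 + x\<^sup>2))) * exp (\<gamma> * x - \<beta> * x\<^sup>2)"
      using C D by (intro mult_right_mono mult_left_mono) auto
    also have "\<dots> = C * D * exp (\<beta> / 2 * (1 + x\<^sup>2) + (\<gamma> * x - \<beta> * x\<^sup>2))"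
      by (simp add: exp_add)
    also have "\<dots> \<le> C * D * exp (\<beta> / 2 + \<gamma>\<^sup>2 / (2 * \<beta>))"
      using C D e by (intro mult_left_mono) auto
    finally show ?thesis .
  qed
  then show ?thesis by (auto simp: bounded_iff)
qed

lemma gauss_weight_schwartz:
  assumes b: "Re b > 0"
  shows "gauss_weight P \<sigma> b c \<in> schwartz"
proof (rule schwartz_coinduct)
  let ?K = "{g. \<exists>P \<sigma>. g = gauss_weight P \<sigma> b c}"
  show "gauss_weight P \<sigma> b c \<in> ?K" by blast
  show "bounded (range g)" if "g \<in> ?K" for g
    using that gauss_weight_bounded[OF b] by auto
  show "(\<lambda>x. of_real x * g x) \<in> ?K" if "g \<in> ?K" for g
  proof -
    from that obtain P \<sigma> where g: "g = gauss_weight P \<sigma> b c" by auto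
    have "(\<lambda>x. of_real x * g x) = gauss_weight (pCons 0 P) \<sigma> b c"
      by (auto simp: g gauss_weight_def)
    then show ?thesis by blast
  qed
  show "\<exists>g'\<in>?K. \<forall>x. (g has_vector_derivative g' x) (at x)" if "g \<in> ?K" for g
  proof -
    from that obtain P \<sigma> where g: "g = gauss_weight P \<sigma> b c" by auto
    \<comment> \<open>All terms of the derivative are brought to the common weight
      (1+x^2)^(\<sigma>-1); the factor \<open>[:1, 0, 1:]\<close> is the power of 1 + x^2 that this
      frees.\<close>
    define Q where "Q = pderiv P * [:1, 0, 1:] + P * [:0, of_real (2 * \<sigma>):] + P * [:c, - 2 * b:] * [:1, 0, 1:]"
    have "(g has_vector_derivative gauss_weight Q (\<sigma> - 1) b c x) (at x)" for x
    proof -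
      have 1: "((\<lambda>x. poly P (of_real x)) has_vector_derivative poly (pderiv P) (of_real x)) (at x)"
        using has_vector_derivative_real_field[OF poly_DERIV[of P "of_real x"]] by simp
      have pos: "1 + x\<^sup>2 > 0" by (simp add: add_pos_nonneg)
      have 2: "((\<lambda>x. complex_of_real ((1 + x\<^sup>2) powr \<sigma>)) has_vector_derivative
          of_real (2 * \<sigma> * x * (1 + x\<^sup>2) powr (\<sigma> - 1))) (at x)"
        using pos by (intro has_vector_derivative_of_real)
          (auto intro!: derivative_eq_intros simp: has_real_derivative_iff_has_vector_derivative[symmetric])
      have 3: "((\<lambda>x. exp (c * of_real x - b * (of_real x)\<^sup>2)) has_vector_derivative
          (c - 2 * b * of_real x) * exp (c * of_real x - b * (of_real x)\<^sup>2)) (at x)"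
        by (intro has_vector_derivative_real_field[of "\<lambda>z. exp (c * z - b * z\<^sup>2)"])
          (auto intro!: derivative_eq_intros)
      define y where "y = (1 + x\<^sup>2) powr (\<sigma> - 1)"
      have p: "(1 + x\<^sup>2) powr \<sigma> = (1 + x\<^sup>2) * y"
        using pos by (simp add: powr_diff y_def)
      show ?thesis
        unfolding g gauss_weight_def[abs_def]
        by (rule has_vector_derivative_eq_rhs,
            rule has_vector_derivative_mult[OF has_vector_derivative_mult[OF 1 2] 3])
          (simp only: p y_def[symmetric], simp add: Q_def algebra_simps power2_eq_square)
    qed
    then show ?thesis by blast
  qed
qed

section \<open>The Fourier transform\<close>

text \<open>Dominated convergence applied to the remainder \<open>R\<close> of the difference
  quotient: the mean value inequality and the bound on \<open>h'\<close> each contribute one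
  \<open>B x\<close>, so 2B dominates.\<close>

lemma has_vector_derivative_integral:
  fixes h h' :: "real \<Rightarrow> 'a \<Rightarrow> 'b :: {banach, second_countable_topology}"
  assumes int: "\<And>t. integrable M (h t)"
    and deriv: "\<And>t x. ((\<lambda>t. h t x) has_vector_derivative h' t x) (at t)"
    and [measurable]: "\<And>t. h' t \<in> borel_measurable M"
    and bound: "\<And>t x. norm (h' t x) \<le> B x" and B: "integrable M B"
  shows "((\<lambda>t. integral\<^sup>L M (h t)) has_vector_derivative integral\<^sup>L M (h' t)) (at t)"
proof -
  have int': "integrable M (h' t)" for t
    by (rule Bochner_Integration.integrable_bound[OF B]) (auto intro!: order_trans[OF bound])
  define R where "R y x = (1 / norm (y - t)) *\<^sub>R (h y x - (h t x + (y - t) *\<^sub>R h' t x))" for y x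
  have Rint: "(1 / norm (y - t)) *\<^sub>R (integral\<^sup>L M (h y) - (integral\<^sup>L M (h t) + (y - t) *\<^sub>R integral\<^sup>L M (h' t)))
      = integral\<^sup>L M (R y)" for y
    unfolding R_def using int int' by simp
  have Rlim: "((\<lambda>y. R y x) \<longlongrightarrow> 0) (at t)" for x
    using deriv[of x t] unfolding has_vector_derivative_def has_derivative_within R_def by simp
  have Rbound: "norm (R y x) \<le> 2 * B x" if "y \<noteq> t" for y x
  proof -
    have "norm (h y x - h t x) \<le> B x * norm (y - t)"
    proof (rule differentiable_bound[of UNIV "\<lambda>t. h t x" "\<lambda>t s. s *\<^sub>R h' t x"])
      show "((\<lambda>t. h t x) has_derivative (\<lambda>s. s *\<^sub>R h' r x)) (at r within UNIV)" for r
        using deriv[of x r] by (simp add: has_vector_derivative_def)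
      have "0 \<le> B x" using order_trans[OF norm_ge_zero bound] .
      then show "onorm (\<lambda>s. s *\<^sub>R h' r x) \<le> B x" for r
        by (intro onorm_bound) (auto simp: mult.commute[of _ "norm (h' r x)"] intro!: mult_right_mono bound)
    qed auto
    moreover have "norm ((y - t) *\<^sub>R h' t x) \<le> norm (y - t) * B x"
      by (auto intro!: mult_left_mono bound)
    ultimately have "norm (h y x - h t x - (y - t) *\<^sub>R h' t x) \<le> 2 * B x * norm (y - t)"
      by (intro order_trans[OF norm_triangle_ineq4]) (simp add: algebra_simps)
    then have "norm (h y x - (h t x + (y - t) *\<^sub>R h' t x)) / norm (y - t) \<le> 2 * B x"
      using that by (simp add: divide_le_eq diff_diff_eq)
    then show ?thesis by (simp add: R_def)
  qed
  have "((\<lambda>y. integral\<^sup>L M (R y)) \<longlongrightarrow> 0) (at t)"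
    unfolding tendsto_at_iff_sequentially
  proof (intro allI impI)
    fix X :: "nat \<Rightarrow> real" assume X: "\<forall>i. X i \<in> UNIV - {t}" "X \<longlonglongrightarrow> t"
    have [measurable]: "R y \<in> borel_measurable M" for y
      unfolding R_def using int int' by measurable
    have "(\<lambda>i. integral\<^sup>L M (R (X i))) \<longlonglongrightarrow> integral\<^sup>L M (\<lambda>x. 0)"
    proof (rule integral_dominated_convergence[where w = "\<lambda>x. 2 * B x"])
      show "AE x in M. (\<lambda>i. R (X i) x) \<longlonglongrightarrow> 0"
        using Rlim X by (auto simp: tendsto_at_iff_sequentially o_def)
      show "AE x in M. norm (R (X i) x) \<le> 2 * B x" for i
        using Rbound X(1) by auto
    qed (use B in auto)
    then show "((\<lambda>y. integral\<^sup>L M (R y)) \<circ> X) \<longlonglongrightarrow> 0" by (simp add: o_def)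
  qed
  then show ?thesis
    unfolding has_vector_derivative_def has_derivative_within Rint[symmetric]
    by (auto intro: bounded_linear_scaleR_left)
qed

section \<open>The Fourier transform exchanges differentiation and multiplication by the
  variable\<close>

lemma integrable_exp_ii_mult:
  assumes "integrable lborel (f :: real \<Rightarrow> complex)"
  shows "integrable lborel (\<lambda>x. exp (- \<i> * of_real (x * \<xi>)) * f x)"
  by (rule Bochner_Integration.integrable_bound[OF assms])
    (use assms in \<open>auto simp: norm_mult\<close>)

lemma fourier_cmult: "fourier (\<lambda>x. c * f x) = (\<lambda>\<xi>. c * fourier f \<xi>)"
  by (simp add: fourier_def fun_eq_iff mult.left_commute[of _ c])

lemma schwartz_mult_x_integrable:
  assumes "f \<in> schwartz" shows "integrable lborel (\<lambda>x. norm (of_real x * f x))"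
  using schwartz_integrable[OF schwartz_mult_x[OF assms]] by simp

lemma fourier_has_vector_derivative:
  assumes f: "f \<in> schwartz"
  shows "(fourier f has_vector_derivative fourier (\<lambda>x. - \<i> * (of_real x * f x)) \<xi>) (at \<xi>)"
proof -
  note [measurable] = schwartz_measurable[OF f]
  have "((\<lambda>\<xi>. LINT x|lborel. exp (- \<i> * of_real (x * \<xi>)) * f x) has_vector_derivative
      (LINT x|lborel. exp (- \<i> * of_real (x * \<xi>)) * (- \<i> * (of_real x * f x)))) (at \<xi>)"
  proof (rule has_vector_derivative_integral[where B = "\<lambda>x. norm (of_real x * f x)"])
    show "integrable lborel (\<lambda>x. exp (- \<i> * of_real (x * \<xi>)) * f x)" for \<xi>
      by (intro integrable_exp_ii_mult schwartz_integrable f)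
    show "((\<lambda>\<xi>. exp (- \<i> * of_real (x * \<xi>)) * f x) has_vector_derivative
        exp (- \<i> * of_real (x * \<xi>)) * (- \<i> * (of_real x * f x))) (at \<xi>)" for \<xi> x
    proof -
      have "((\<lambda>z. exp (- \<i> * (of_real x * z)) * f x) has_field_derivative
        exp (- \<i> * (of_real x * of_real \<xi>)) * (- \<i> * (of_real x * f x))) (at (of_real \<xi>))"
        by (auto intro!: derivative_eq_intros)
      from has_vector_derivative_real_field[OF this] show ?thesis by simp
    qed
  qed (use schwartz_mult_x_integrable[OF f] in \<open>auto simp: norm_mult\<close>)
  then show ?thesis by (simp add: fourier_def[abs_def])
qed

text \<open>Integration by parts on the line: applied to a product g, the vanishing limits remove
  the boundary terms.\<close>

lemma integral_deriv_eq_0: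
  fixes g g' :: "real \<Rightarrow> complex"
  assumes "\<And>x. (g has_vector_derivative g' x) (at x)" "continuous_on UNIV g'" "integrable lborel g'"
    "(g \<longlongrightarrow> 0) at_top" "(g \<longlongrightarrow> 0) at_bot"
  shows "integral\<^sup>L lborel g' = 0"
proof -
  have "(LBINT x=-\<infinity>..\<infinity>. g' x) = 0 - 0"
  proof (rule interval_integral_FTC_integrable[where F = g])
    show "((g \<circ> real_of_ereal) \<longlongrightarrow> 0) (at_right (- \<infinity>))" "((g \<circ> real_of_ereal) \<longlongrightarrow> 0) (at_left \<infinity>)"
      using assms by (auto simp: ereal_tendsto_simps)
    show "isCont g' x" for x using assms(2) by (simp add: continuous_on_eq_continuous_at)
    show "set_integrable lborel (einterval (- \<infinity>) \<infinity>) g'"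
      using assms(3) by (simp add: set_integrable_def einterval_def)
  qed (use assms in auto)
  then show ?thesis
    by (simp add: interval_lebesgue_integral_def set_lebesgue_integral_def einterval_def)
qed

lemma schwartz_tendsto_0:
  assumes f: "f \<in> schwartz"
  shows "(f \<longlongrightarrow> 0) at_top" "(f \<longlongrightarrow> 0) at_bot"
proof -
  obtain C where C: "C > 0" "\<And>x. norm (f x) \<le> C / (1 + x\<^sup>2)" using schwartz_decay[OF f] by meson
  have "((\<lambda>x::real. C / (1 + x\<^sup>2)) \<longlongrightarrow> 0) at_top" "((\<lambda>x::real. C / (1 + x\<^sup>2)) \<longlongrightarrow> 0) at_bot"
    by real_asymp+
  from this[THEN Lim_null_comparison[rotated, where f = f]] C(2)
  show "(f \<longlongrightarrow> 0) at_top" "(f \<longlongrightarrow> 0) at_bot" by auto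
qed

lemma fourier_deriv:
  assumes f: "f \<in> schwartz"
  shows "fourier (nderiv 1 f) \<xi> = \<i> * of_real \<xi> * fourier f \<xi>"
proof -
  note f' = schwartz_nderiv[OF f, of 1]
  define e where "e x = exp (- \<i> * of_real (x * \<xi>))" for x :: real
  have e1: "(e has_vector_derivative - \<i> * of_real \<xi> * e x) (at x)" for x
  proof -
    have "((\<lambda>z. exp (- \<i> * (z * of_real \<xi>))) has_field_derivative
       - \<i> * of_real \<xi> * exp (- \<i> * (of_real x * of_real \<xi>))) (at (of_real x))"
      by (auto intro!: derivative_eq_intros)
    from has_vector_derivative_real_field[OF this] show ?thesis by (simp add: e_def[abs_def])
  qed
  have ec: "continuous_on UNIV e" unfolding e_def[abs_def] by (intro continuous_intros)
  have en: "norm (e x) = 1" for x by (simp add: e_def)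
  have i: "integrable lborel (\<lambda>x. e x * g x)" if "g \<in> schwartz" for g
    unfolding e_def using integrable_exp_ii_mult[OF schwartz_integrable[OF that]] by simp
  have "integral\<^sup>L lborel (\<lambda>x. e x * nderiv 1 f x + - \<i> * of_real \<xi> * (e x * f x)) = 0"
  proof (rule integral_deriv_eq_0[where g = "\<lambda>x. e x * f x"])
    show "((\<lambda>x. e x * f x) has_vector_derivative e x * nderiv 1 f x + - \<i> * of_real \<xi> * (e x * f x)) (at x)" for x
      using has_vector_derivative_mult[OF e1 schwartz_has_vector_derivative[OF f, of 0 x]]
      by (simp add: mult.assoc)
    show "continuous_on UNIV (\<lambda>x. e x * nderiv 1 f x + - \<i> * of_real \<xi> * (e x * f x))"
      by (intro continuous_intros ec schwartz_continuous f f')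
    show "integrable lborel (\<lambda>x. e x * nderiv 1 f x + - \<i> * of_real \<xi> * (e x * f x))"
      using i[OF f] i[OF f'] by auto
    show "((\<lambda>x. e x * f x) \<longlongrightarrow> 0) at_top" "((\<lambda>x. e x * f x) \<longlongrightarrow> 0) at_bot"
      using schwartz_tendsto_0[OF f] by (auto simp: tendsto_norm_zero_iff[symmetric, of "\<lambda>x. e x * f x"] norm_mult en tendsto_norm_zero)
  qed
  then have "integral\<^sup>L lborel (\<lambda>x. e x * nderiv 1 f x) + - \<i> * of_real \<xi> * integral\<^sup>L lborel (\<lambda>x. e x * f x) = 0"
    using i[OF f] i[OF f'] by simp
  then show ?thesis by (simp add: fourier_def e_def algebra_simps)
qed

lemma norm_fourier_le: "norm (fourier f \<xi>) \<le> (LINT x|lborel. norm (f x))"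
  unfolding fourier_def
  using integral_norm_bound[of lborel "\<lambda>x. exp (- \<i> * of_real (x * \<xi>)) * f x"]
  by (simp add: norm_mult)

text \<open>The image of the Schwartz space under \<open>fourier\<close> is itself a stable class,
  since d/dx and multiplication by x change places; boundedness comes from the L^1 norm.\<close>

lemma fourier_schwartz:
  assumes f: "f \<in> schwartz" shows "fourier f \<in> schwartz"
proof (rule schwartz_coinduct)
  show "fourier f \<in> fourier ` schwartz" using f by blast
  show "bounded (range g)" if "g \<in> fourier ` schwartz" for g
    using that norm_fourier_le by (auto simp: bounded_iff)
  show "\<exists>g'\<in>fourier ` schwartz. \<forall>x. (g has_vector_derivative g' x) (at x)"
    if "g \<in> fourier ` schwartz" for g
  proof -
    from that obtain h where h: "h \<in> schwartz" "g = fourier h" by blast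
    then show ?thesis
      using fourier_has_vector_derivative[OF h(1)] schwartz_cmult[OF schwartz_mult_x[OF h(1)], of "- \<i>"]
      by blast
  qed
  show "(\<lambda>x. of_real x * g x) \<in> fourier ` schwartz" if "g \<in> fourier ` schwartz" for g
  proof -
    from that obtain h where h: "h \<in> schwartz" "g = fourier h" by blast
    have "(\<lambda>x. of_real x * g x) = fourier (\<lambda>x. - \<i> * nderiv 1 h x)"
      unfolding fourier_cmult fourier_deriv[OF h(1)] h(2) by (simp add: fun_eq_iff flip: mult.assoc)
    then show ?thesis using schwartz_cmult[OF schwartz_nderiv[OF h(1), of 1], of "- \<i>"] by blast
  qed
qed

text \<open>Fubini with a kernel symmetric in its two variables. It serves the inversion formula
  and, later, the pairing with the chirp.\<close>

lemma fourier_mult_formula: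
  assumes f: "integrable lborel f" and g: "integrable lborel g"
  shows "(LINT x|lborel. fourier f x * g x) = (LINT x|lborel. f x * fourier g x)"
proof -
  have [measurable]: "f \<in> borel_measurable borel" "g \<in> borel_measurable borel" using f g by auto
  have *: "integrable (lborel \<Otimes>\<^sub>M lborel) (\<lambda>(y, x). exp (- \<i> * of_real (y * x)) * f y * g x)"
  proof (rule lborel_pair.Fubini_integrable)
    show "integrable lborel (\<lambda>y. LINT x|lborel. norm (case (y, x) of (y, x) \<Rightarrow> exp (- \<i> * of_real (y * x)) * f y * g x))"
      using f by (simp add: norm_mult)
    show "AE y in lborel. integrable lborel (\<lambda>x. case (y, x) of (y, x) \<Rightarrow> exp (- \<i> * of_real (y * x)) * f y * g x)"
    proof (rule AE_I2)
      fix y :: real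
      have "integrable lborel (\<lambda>x. f y * (exp (- \<i> * of_real (x * y)) * g x))"
        using integrable_exp_ii_mult[OF g, of y] by simp
      then show "integrable lborel (\<lambda>x. case (y, x) of (y, x) \<Rightarrow> exp (- \<i> * of_real (y * x)) * f y * g x)"
        by (simp add: mult_ac)
    qed
  qed measurable
  have "(LINT x|lborel. fourier f x * g x) =
      (LINT x|lborel. LINT y|lborel. exp (- \<i> * of_real (y * x)) * f y * g x)"
    unfolding fourier_def by (simp add: integral_mult_left_zero[symmetric] del: integral_mult_left_zero)
  also have "\<dots> = (LINT y|lborel. LINT x|lborel. exp (- \<i> * of_real (y * x)) * f y * g x)"
    using lborel_pair.Fubini_integral[OF *] by simp
  also have "\<dots> = (LINT x|lborel. f x * fourier g x)"
    unfolding fourier_def by (simp add: integral_mult_right_zero[symmetric] mult_ac del: integral_mult_right_zero)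
  finally show ?thesis .
qed

section \<open>Gaussians and Fourier inversion\<close>

lemma vector_derivative_zero_eq:
  fixes f :: "real \<Rightarrow> 'a :: real_normed_vector"
  assumes "\<And>x. (f has_vector_derivative 0) (at x)"
  shows "f x = f y"
  using has_vector_derivative_zero_constant[of UNIV f] assms by (metis convex_UNIV UNIV_I)

definition gauss :: "complex \<Rightarrow> real \<Rightarrow> complex" where
  "gauss b x = exp (- b * (of_real x)\<^sup>2)"

lemma gauss_eq_weight: "gauss b = gauss_weight 1 0 b 0"
  by (auto simp: gauss_def gauss_weight_def fun_eq_iff add_nonneg_eq_0_iff)

lemma gauss_schwartz: "Re b > 0 \<Longrightarrow> gauss b \<in> schwartz"
  by (simp add: gauss_eq_weight gauss_weight_schwartz)

lemma gauss_deriv: "nderiv 1 (gauss b) = (\<lambda>x. - 2 * b * (of_real x * gauss b x))"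
proof
  fix x
  have "(gauss b has_vector_derivative - 2 * b * (of_real x * gauss b x)) (at x)"
    unfolding gauss_def[abs_def]
    by (intro has_vector_derivative_real_field[of "\<lambda>z. exp (- b * z\<^sup>2)"])
      (auto intro!: derivative_eq_intros)
  then show "nderiv 1 (gauss b) x = - 2 * b * (of_real x * gauss b x)"
    by (simp add: nderiv_def vector_derivative_at)
qed

lemma norm_gauss: "norm (gauss b x) = exp (- Re b * x\<^sup>2)"
proof -
  have "Re (b * (of_real x)\<^sup>2) = Re b * x\<^sup>2" by (simp flip: of_real_power)
  then show ?thesis by (simp add: gauss_def)
qed

text \<open>The transform solves F' = -(\<xi>/(2b)) F, because x times a Gaussian is a multiple of
  its derivative. The value at 0 stays an integral, which avoids choosing a branch of the complex
  square root.\<close>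

lemma fourier_gauss_aux:
  assumes b: "Re b > 0"
  shows "fourier (gauss b) \<xi> = integral\<^sup>L lborel (gauss b) * exp (- (of_real \<xi>)\<^sup>2 / (4 * b))"
proof -
  have b0: "b \<noteq> 0" using b by auto
  note g = gauss_schwartz[OF b]
  define E where "E \<xi> = exp ((of_real \<xi>)\<^sup>2 / (4 * b))" for \<xi> :: real
  have E: "(E has_vector_derivative of_real \<xi> / (2 * b) * E \<xi>) (at \<xi>)" for \<xi>
    unfolding E_def[abs_def] using b0
    by (intro has_vector_derivative_real_field[of "\<lambda>z. exp (z\<^sup>2 / (4 * b))"])
      (auto intro!: derivative_eq_intros)
  have "(\<lambda>x. - \<i> * (of_real x * gauss b x)) = (\<lambda>x. \<i> / (2 * b) * nderiv 1 (gauss b) x)"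
    unfolding gauss_deriv using b0 by (auto simp: field_simps)
  then have F: "(fourier (gauss b) has_vector_derivative
      \<i> / (2 * b) * (\<i> * of_real \<xi> * fourier (gauss b) \<xi>)) (at \<xi>)" for \<xi>
    using fourier_has_vector_derivative[OF g, of \<xi>]
    by (simp only: fourier_cmult fourier_deriv[OF g])
  have "((\<lambda>\<xi>. fourier (gauss b) \<xi> * E \<xi>) has_vector_derivative 0) (at \<xi>)" for \<xi>
  proof -
    have "fourier (gauss b) \<xi> * (of_real \<xi> / (2 * b) * E \<xi>)
        + \<i> / (2 * b) * (\<i> * of_real \<xi> * fourier (gauss b) \<xi>) * E \<xi> = 0"
      using b0 by (simp add: field_simps)
    with has_vector_derivative_mult[OF F E] show ?thesis by metis
  qed
  then have "fourier (gauss b) \<xi> * E \<xi> = fourier (gauss b) 0 * E 0"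
    by (rule vector_derivative_zero_eq)
  then show ?thesis
    by (simp add: E_def fourier_def exp_minus field_simps)
qed

section \<open>The Gaussian integral for real and complex parameters\<close>

lemma gauss_integral_real:
  assumes a: "a > (0::real)"
  shows "has_bochner_integral lborel (\<lambda>x. exp (- a * x\<^sup>2)) (sqrt (pi / a))"
proof -
  define \<sigma> where "\<sigma> = sqrt (1 / (2 * a))"
  have s: "\<sigma> > 0" "\<sigma>\<^sup>2 = 1 / (2 * a)" using a by (auto simp: \<sigma>_def)
  have 1: "normal_density 0 \<sigma> x = exp (- a * x\<^sup>2) / sqrt (pi / a)" for x
    using a by (simp add: normal_density_def s(2) field_simps)
  have "has_bochner_integral lborel (\<lambda>x. sqrt (pi / a) * normal_density 0 \<sigma> x) (sqrt (pi / a) * 1)"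
    using s by (intro has_bochner_integral_mult_right)
      (simp_all add: has_bochner_integral_iff integral_normal_density integrable_normal_density)
  moreover have "(\<lambda>x. sqrt (pi / a) * normal_density 0 \<sigma> x) = (\<lambda>x. exp (- a * x\<^sup>2))"
    using a by (simp add: 1)
  ultimately show ?thesis by simp
qed

lemma gauss_integral_of_real:
  assumes "a > (0::real)"
  shows "integral\<^sup>L lborel (gauss (of_real a)) = of_real (sqrt (pi / a))"
proof -
  have "gauss (of_real a) = (\<lambda>x. of_real (exp (- a * x\<^sup>2)))"
    by (auto simp: gauss_def exp_of_real[symmetric])
  then show ?thesis using gauss_integral_real[OF assms]
    by (simp add: has_bochner_integral_iff)
qed

text \<open>The left-hand side is constant along vertical lines in \<open>b\<close>.\<close>
lemma gauss_integral_sq: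
  assumes b: "Re b > 0"
  shows "(integral\<^sup>L lborel (gauss b))\<^sup>2 * b = of_real pi"
proof -
  define \<alpha> where "\<alpha> = Re b"
  have \<alpha>: "\<alpha> > 0" using b by (simp add: \<alpha>_def)
  \<comment> \<open>The vertical path from the real parameter \<alpha> to b. Along it the modulus of
    the Gaussian does not change, so one dominating function serves all \<tau>.\<close>
  define c where "c = (\<lambda>\<tau>. of_real \<alpha> + \<i> * of_real \<tau>)"
  have c: "Re (c \<tau>) > 0" "c \<tau> \<noteq> 0" for \<tau> using \<alpha> by (auto simp: c_def complex_eq_iff)
  have cd: "(c has_vector_derivative \<i>) (at \<tau>)" for \<tau>
  proof -
    have "((\<lambda>z. of_real \<alpha> + \<i> * z) has_field_derivative \<i>) (at (of_real \<tau>))"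
      by (auto intro!: derivative_eq_intros)
    from has_vector_derivative_real_field[OF this] show ?thesis
      by (simp add: c_def)
  qed
  define \<kappa> where "\<kappa> \<tau> = integral\<^sup>L lborel (gauss (c \<tau>))" for \<tau>
  have x2: "(\<lambda>x. of_real x * (of_real x * gauss b x)) \<in> schwartz" if "Re b > 0" for b
    by (intro schwartz_mult_x gauss_schwartz that)
  \<comment> \<open>The second moment, from the fact that the derivative of x times the Gaussian has
    integral 0.\<close>
  have m2: "integral\<^sup>L lborel (\<lambda>x. of_real x * (of_real x * gauss b x)) = integral\<^sup>L lborel (gauss b) / (2 * b)"
    if b: "Re b > 0" for b
  proof -
    have b0: "b \<noteq> 0" using b by auto
    have "integral\<^sup>L lborel (\<lambda>x. gauss b x + - 2 * b * (of_real x * (of_real x * gauss b x))) = 0"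
    proof (rule integral_deriv_eq_0[where g = "\<lambda>x. of_real x * gauss b x"])
      show "((\<lambda>x. of_real x * gauss b x) has_vector_derivative
          gauss b x + - 2 * b * (of_real x * (of_real x * gauss b x))) (at x)" for x
        using has_vector_derivative_mult[OF has_vector_derivative_of_real[OF DERIV_ident]
            schwartz_has_vector_derivative[OF gauss_schwartz[OF b], of 0 x, simplified]]
          gauss_deriv[of b]
        by (simp add: algebra_simps)
      show "continuous_on UNIV (\<lambda>x. gauss b x + - 2 * b * (of_real x * (of_real x * gauss b x)))"
        by (intro continuous_intros schwartz_continuous gauss_schwartz b)
      show "integrable lborel (\<lambda>x. gauss b x + - 2 * b * (of_real x * (of_real x * gauss b x)))"
        using schwartz_integrable[OF gauss_schwartz[OF b]] schwartz_integrable[OF x2[OF b]] by auto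
      show "((\<lambda>x. of_real x * gauss b x) \<longlongrightarrow> 0) at_top" "((\<lambda>x. of_real x * gauss b x) \<longlongrightarrow> 0) at_bot"
        using schwartz_tendsto_0[OF schwartz_mult_x[OF gauss_schwartz[OF b]]] by auto
    qed
    then have "integral\<^sup>L lborel (gauss b) +
        - 2 * b * integral\<^sup>L lborel (\<lambda>x. of_real x * (of_real x * gauss b x)) = 0"
      using Bochner_Integration.integral_add[OF schwartz_integrable[OF gauss_schwartz[OF b]]
          integrable_mult_right[OF schwartz_integrable[OF x2[OF b]], of "- 2 * b"]]
      by (simp only: integral_mult_right_zero)
    then show ?thesis using b0 by (simp add: field_simps)
  qed
  have kd: "(\<kappa> has_vector_derivative - \<i> * (\<kappa> \<tau> / (2 * c \<tau>))) (at \<tau>)" for \<tau>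
  proof -
    have "((\<lambda>\<tau>. integral\<^sup>L lborel (gauss (c \<tau>))) has_vector_derivative
        integral\<^sup>L lborel (\<lambda>x. - \<i> * (of_real x * (of_real x * gauss (c \<tau>) x)))) (at \<tau>)"
    proof (rule has_vector_derivative_integral[where B = "\<lambda>x. norm (of_real x * (of_real x * gauss (of_real \<alpha>) x))"])
      show "integrable lborel (gauss (c \<tau>))" for \<tau>
        by (intro schwartz_integrable gauss_schwartz c)
      show "((\<lambda>\<tau>. gauss (c \<tau>) x) has_vector_derivative - \<i> * (of_real x * (of_real x * gauss (c \<tau>) x))) (at \<tau>)" for \<tau> x
      proof -
        have "((\<lambda>z. exp (- (of_real \<alpha> + \<i> * z) * (of_real x)\<^sup>2)) has_field_derivative
           - \<i> * (of_real x * (of_real x * exp (- (of_real \<alpha> + \<i> * of_real \<tau>) * (of_real x)\<^sup>2)))) (at (of_real \<tau>))"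
          by (auto intro!: derivative_eq_intros simp: power2_eq_square)
        from has_vector_derivative_real_field[OF this] show ?thesis
          by (simp add: gauss_def c_def)
      qed
      show "(\<lambda>x. - \<i> * (of_real x * (of_real x * gauss (c \<tau>) x))) \<in> borel_measurable lborel" for \<tau>
        using schwartz_measurable[OF x2[OF c(1)]] by simp
      show "norm (- \<i> * (of_real x * (of_real x * gauss (c \<tau>) x)))
          \<le> norm (of_real x * (of_real x * gauss (of_real \<alpha>) x))" for \<tau> x
        by (simp add: norm_mult norm_gauss c_def)
      show "integrable lborel (\<lambda>x. norm (of_real x * (of_real x * gauss (of_real \<alpha>) x)))"
        using schwartz_integrable[OF x2[of "of_real \<alpha>"]] \<alpha> by (intro integrable_norm) simp
    qed
    also have "integral\<^sup>L lborel (\<lambda>x. - \<i> * (of_real x * (of_real x * gauss (c \<tau>) x)))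
        = - \<i> * (\<kappa> \<tau> / (2 * c \<tau>))"
      unfolding \<kappa>_def m2[OF c(1), symmetric] by (rule integral_mult_right_zero)
    finally show ?thesis by (simp add: \<kappa>_def[abs_def])
  qed
  \<comment> \<open>Since \<kappa>' = -i\<kappa>/(2c) and c' = i, the terms 2\<kappa>\<kappa>'c and
    \<kappa>^2 c' cancel.\<close>
  have "((\<lambda>\<tau>. \<kappa> \<tau> * \<kappa> \<tau> * c \<tau>) has_vector_derivative 0) (at \<tau>)" for \<tau>
    by (rule has_vector_derivative_eq_rhs,
        rule has_vector_derivative_mult[OF has_vector_derivative_mult[OF kd kd] cd])
      (use c in \<open>simp add: field_simps\<close>)
  then have "\<kappa> (Im b) * \<kappa> (Im b) * c (Im b) = \<kappa> 0 * \<kappa> 0 * c 0"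
    by (rule vector_derivative_zero_eq)
  moreover have "c (Im b) = b" "c 0 = of_real \<alpha>" by (auto simp: c_def \<alpha>_def complex_eq_iff)
  moreover have "\<kappa> 0 * \<kappa> 0 * c 0 = of_real pi"
  proof -
    have "sqrt (pi / \<alpha>) * sqrt (pi / \<alpha>) * \<alpha> = pi" using \<alpha> by simp
    then show ?thesis
      unfolding \<kappa>_def \<open>c 0 = _\<close> gauss_integral_of_real[OF \<alpha>] of_real_mult[symmetric] by simp
  qed
  ultimately show ?thesis by (simp add: \<kappa>_def power2_eq_square)
qed

text \<open>The modulus does not see the sign that the square leaves open, and it is what the lower
  bound for the chirp uses.\<close>

lemma norm_gauss_integral:
  assumes b: "Re b > 0"
  shows "norm (integral\<^sup>L lborel (gauss b)) = sqrt (pi / norm b)"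
proof -
  have "b \<noteq> 0" using b by auto
  have "norm ((integral\<^sup>L lborel (gauss b))\<^sup>2 * b) = pi"
    by (simp only: gauss_integral_sq[OF b]) simp
  then have "(norm (integral\<^sup>L lborel (gauss b)))\<^sup>2 = pi / norm b"
    using \<open>b \<noteq> 0\<close> by (simp add: norm_mult norm_power field_simps)
  then show ?thesis by (metis norm_ge_zero real_sqrt_unique)
qed

text \<open>A Gaussian cutoff in frequency is inserted. As it is removed, one side tends to the
  inversion integral; after the multiplication formula the other side is f averaged against a
  Gaussian concentrating at x.\<close>

lemma fourier_inversion:
  assumes f: "integrable lborel f" "continuous_on UNIV f" "bounded (range f)"
    and F: "integrable lborel (fourier f)"
  shows "inv_fourier (fourier f) x = f x"
proof -
  have [measurable]: "f \<in> borel_measurable borel" "fourier f \<in> borel_measurable borel"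
    using f F by auto
  obtain C where C: "\<And>y. norm (f y) \<le> C" using f(3) by (auto simp: bounded_iff)
  \<comment> \<open>With this parameter the transform of \<open>e n\<close> is a Gaussian of width
    1/(n+1) around x. The substitution y = x + z/(n+1) then makes the kernel independent of
    n.\<close>
  define b where "b n = 1 / (2 * (real (Suc n))\<^sup>2)" for n
  have b: "b n > 0" for n by (simp add: b_def)
  define e where "e n \<xi> = exp (\<i> * of_real (x * \<xi>)) * gauss (of_real (b n)) \<xi>" for n and \<xi> :: real
  have ei: "integrable lborel (e n)" for n
    using integrable_exp_ii_mult[OF schwartz_integrable[OF gauss_schwartz[of "of_real (b n)"]], of "- x"] b
    by (simp add: e_def[abs_def] mult.commute)
  have Fe: "fourier (e n) y = of_real (sqrt (2 * pi) * Suc n * exp (- (Suc n * (y - x))\<^sup>2 / 2))" for n y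
  proof -
    have "fourier (e n) y = fourier (gauss (of_real (b n))) (y - x)"
      unfolding fourier_def e_def
      by (intro Bochner_Integration.integral_cong refl) (simp add: mult_exp_exp algebra_simps)
    also have "\<dots> = of_real (sqrt (pi / b n)) * exp (- (of_real (y - x))\<^sup>2 / (4 * of_real (b n)))"
      using b by (subst fourier_gauss_aux) (simp_all add: gauss_integral_of_real)
    also have "- (complex_of_real (y - x))\<^sup>2 / (4 * of_real (b n)) = of_real (- (Suc n * (y - x))\<^sup>2 / 2)"
      by (simp add: b_def power_mult_distrib)
    also have "sqrt (pi / b n) = sqrt (2 * pi) * Suc n"
      by (simp add: b_def real_sqrt_mult)
    finally show ?thesis by (simp only: exp_of_real of_real_mult)
  qed
  have I: "(LINT \<xi>|lborel. fourier f \<xi> * e n \<xi>)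
      = (LINT z|lborel. of_real (sqrt (2 * pi) * exp (- z\<^sup>2 / 2)) * f (x + z / Suc n))" for n
  proof -
    have "(LINT \<xi>|lborel. fourier f \<xi> * e n \<xi>) = (LINT y|lborel. f y * fourier (e n) y)"
      by (rule fourier_mult_formula[OF f(1) ei])
    also have "\<dots> = (1 / Suc n) *\<^sub>R (LINT z|lborel. f (x + (1 / Suc n) * z) * fourier (e n) (x + (1 / Suc n) * z))"
      by (subst lborel_integral_real_affine[of "1 / Suc n" _ x]) simp_all
    also have "\<dots> = (LINT z|lborel. (1 / Suc n) *\<^sub>R (f (x + (1 / Suc n) * z) * fourier (e n) (x + (1 / Suc n) * z)))"
      by simp
    also have "\<dots> = (LINT z|lborel. of_real (sqrt (2 * pi) * exp (- z\<^sup>2 / 2)) * f (x + z / Suc n))"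
      by (intro Bochner_Integration.integral_cong refl)
        (simp add: Fe scaleR_conv_of_real field_simps del: of_nat_Suc)
    finally show ?thesis .
  qed
  have "(\<lambda>n. LINT \<xi>|lborel. fourier f \<xi> * e n \<xi>) \<longlonglongrightarrow> (LINT \<xi>|lborel. fourier f \<xi> * exp (\<i> * of_real (x * \<xi>)))"
  proof (rule integral_dominated_convergence[where w = "\<lambda>\<xi>. norm (fourier f \<xi>)"])
    show "AE \<xi> in lborel. (\<lambda>n. fourier f \<xi> * e n \<xi>) \<longlonglongrightarrow> fourier f \<xi> * exp (\<i> * of_real (x * \<xi>))"
    proof (rule AE_I2)
      fix \<xi>
      have "b \<longlonglongrightarrow> 0" unfolding b_def[abs_def] by real_asymp
      then have "(\<lambda>n. fourier f \<xi> * e n \<xi>) \<longlonglongrightarrow> fourier f \<xi> * (exp (\<i> * of_real (x * \<xi>)) * exp (- of_real 0 * (of_real \<xi>)\<^sup>2))"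
        unfolding e_def gauss_def by (intro tendsto_intros)
      then show "(\<lambda>n. fourier f \<xi> * e n \<xi>) \<longlonglongrightarrow> fourier f \<xi> * exp (\<i> * of_real (x * \<xi>))" by simp
    qed
    show "AE \<xi> in lborel. norm (fourier f \<xi> * e n \<xi>) \<le> norm (fourier f \<xi>)" for n
      using b[of n] by (auto simp: norm_mult e_def norm_gauss intro!: mult_left_le)
    show "(\<lambda>\<xi>. fourier f \<xi> * e n \<xi>) \<in> borel_measurable lborel" for n
      using ei[of n] by measurable
  qed (use F in auto)
  moreover have "(\<lambda>n. LINT \<xi>|lborel. fourier f \<xi> * e n \<xi>) \<longlonglongrightarrow>
      (LINT z|lborel. of_real (sqrt (2 * pi) * exp (- z\<^sup>2 / 2)) * f x)"
    unfolding I
  proof (rule integral_dominated_convergence[where w = "\<lambda>z. sqrt (2 * pi) * exp (- z\<^sup>2 / 2) * C"])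
    show "AE z in lborel. (\<lambda>n. of_real (sqrt (2 * pi) * exp (- z\<^sup>2 / 2)) * f (x + z / Suc n))
        \<longlonglongrightarrow> of_real (sqrt (2 * pi) * exp (- z\<^sup>2 / 2)) * f x"
    proof (rule AE_I2)
      fix z :: real
      have "(\<lambda>n. x + z / Suc n) \<longlonglongrightarrow> x" by real_asymp
      moreover have "isCont f x" using f(2) by (simp add: continuous_on_eq_continuous_at)
      ultimately have "(\<lambda>n. f (x + z / Suc n)) \<longlonglongrightarrow> f x" by (rule isCont_tendsto_compose[rotated])
      then show "(\<lambda>n. of_real (sqrt (2 * pi) * exp (- z\<^sup>2 / 2)) * f (x + z / Suc n))
        \<longlonglongrightarrow> of_real (sqrt (2 * pi) * exp (- z\<^sup>2 / 2)) * f x" by (intro tendsto_intros)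
    qed
    show "integrable lborel (\<lambda>z. sqrt (2 * pi) * exp (- z\<^sup>2 / 2) * C)"
      using gauss_integral_real[of "1 / 2"] by (auto simp: has_bochner_integral_iff)
    show "AE z in lborel. norm (of_real (sqrt (2 * pi) * exp (- z\<^sup>2 / 2)) * f (x + z / Suc n))
        \<le> sqrt (2 * pi) * exp (- z\<^sup>2 / 2) * C" for n
      by (rule AE_I2) (simp add: norm_mult C mult_left_mono)
  qed measurable
  moreover have "(LINT z|lborel. of_real (sqrt (2 * pi) * exp (- z\<^sup>2 / 2)) * f x) = of_real (2 * pi) * f x"
  proof -
    have "(LINT z|lborel. sqrt (2 * pi) * exp (- z\<^sup>2 / 2)) = 2 * pi"
      using gauss_integral_real[of "1 / 2"]
      by (simp add: has_bochner_integral_iff mult.commute)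
    then have "(LINT z|lborel. complex_of_real (sqrt (2 * pi) * exp (- z\<^sup>2 / 2))) = of_real (2 * pi)"
      by (simp only: integral_complex_of_real)
    then show ?thesis by (simp only: integral_mult_left_zero)
  qed
  ultimately have "(LINT \<xi>|lborel. fourier f \<xi> * exp (\<i> * of_real (x * \<xi>))) = of_real (2 * pi) * f x"
    using LIMSEQ_unique by metis
  then show ?thesis by (simp add: inv_fourier_def mult.commute)
qed

lemma schwartz_inversion: "f \<in> schwartz \<Longrightarrow> inv_fourier (fourier f) = f"
  using fourier_inversion[of f] schwartz_bounded[of f 0 0]
  by (auto simp: fun_eq_iff schwartz_integrable fourier_schwartz schwartz_continuous bounded_iff)

section \<open>Uniqueness of densities\<close>

text \<open>At each point one of the two parts is 0, so if they agree both are.\<close>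

lemma AE_zero_if_pos_neg_density_eq:
  fixes h :: "real \<Rightarrow> real"
  assumes [measurable]: "h \<in> borel_measurable borel"
    and eq: "density lborel (\<lambda>x. ennreal (max 0 (h x))) = density lborel (\<lambda>x. ennreal (max 0 (- h x)))"
  shows "AE x in lborel. h x = 0"
proof -
  have "AE x in lborel. ennreal (max 0 (h x)) = ennreal (max 0 (- h x))"
    using eq by (intro sigma_finite_measure.density_unique[OF lborel.sigma_finite_measure_axioms]) auto
  then show ?thesis by eventually_elim (auto simp: max_def split: if_splits)
qed

lemma integrable_pos_part:
  fixes h :: "'a \<Rightarrow> real"
  assumes "integrable M h" shows "integrable M (\<lambda>x. max 0 (h x))"
  by (rule integrable_max) (use assms in auto)

text \<open>Positive and negative part of h have the same transform, in particular the same mass m,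
  read off at t = 0. Divided by m they are probability densities with equal characteristic
  functions, and Levy's theorem identifies them.\<close>

lemma AE_zero_if_char_zero_real:
  fixes h :: "real \<Rightarrow> real"
  assumes h: "integrable lborel h"
    and zero: "\<And>t. (LINT x|lborel. iexp (t * x) * of_real (h x)) = 0"
  shows "AE x in lborel. h x = 0"
proof -
  have [measurable]: "h \<in> borel_measurable borel" using h by auto
  define f where "f \<sigma> x = max 0 (\<sigma> * h x)" for \<sigma> x
  have fi: "integrable lborel (f \<sigma>)" for \<sigma>
    unfolding f_def[abs_def] using h by (intro integrable_pos_part) auto
  have [measurable]: "f \<sigma> \<in> borel_measurable borel" for \<sigma> unfolding f_def[abs_def] by measurable
  have fnn: "f \<sigma> x \<ge> 0" for \<sigma> x by (simp add: f_def)
  have ei: "integrable lborel (\<lambda>x. iexp (t * x) * of_real (f \<sigma> x))" for t \<sigma>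
    by (rule Bochner_Integration.integrable_bound[OF fi[of \<sigma>]]) (auto simp: norm_mult)
  have eq: "(LINT x|lborel. iexp (t * x) * of_real (f 1 x)) = (LINT x|lborel. iexp (t * x) * of_real (f (- 1) x))" for t
  proof -
    have "(\<lambda>x. iexp (t * x) * of_real (h x)) =
        (\<lambda>x. iexp (t * x) * of_real (f 1 x) - iexp (t * x) * of_real (f (- 1) x))"
    proof
      fix x
      have "h x = f 1 x - f (- 1) x" by (auto simp: f_def)
      then show "iexp (t * x) * of_real (h x) = iexp (t * x) * of_real (f 1 x) - iexp (t * x) * of_real (f (- 1) x)"
        by (simp add: right_diff_distrib)
    qed
    with zero[of t] ei[of t] show ?thesis by simp
  qed
  define m where "m = integral\<^sup>L lborel (f 1)"
  have m: "integral\<^sup>L lborel (f \<sigma>) = m" if "\<sigma> \<in> {1, - 1}" for \<sigma>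
    using eq[of 0] that by (auto simp: m_def)
  have m0: "m \<ge> 0" unfolding m_def by (intro integral_nonneg_AE) (simp add: fnn)
  show ?thesis
  proof (cases "m = 0")
    case True
    have "AE x in lborel. f \<sigma> x = 0" if "\<sigma> \<in> {1, - 1}" for \<sigma>
      using integral_nonneg_eq_0_iff_AE[OF fi[of \<sigma>]] m[OF that] True fnn by auto
    from this[of 1] this[of "- 1"] have "AE x in lborel. f 1 x = 0" "AE x in lborel. f (- 1) x = 0" by auto
    then show ?thesis by eventually_elim (auto simp: f_def max_def split: if_splits)
  next
    case False
    with m0 have m1: "m > 0" by simp
    define D where "D \<sigma> = density lborel (\<lambda>x. ennreal (f \<sigma> x / m))" for \<sigma>
    have D: "real_distribution (D \<sigma>)" if "\<sigma> \<in> {1, - 1}" for \<sigma>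
    proof -
      have "emeasure (D \<sigma>) (space (D \<sigma>)) = (\<integral>\<^sup>+ x. ennreal (f \<sigma> x / m) \<partial>lborel)"
        by (simp add: D_def emeasure_density)
      also have "\<dots> = ennreal (integral\<^sup>L lborel (\<lambda>x. f \<sigma> x / m))"
        using m1 fnn fi by (intro nn_integral_eq_integral) auto
      also have "\<dots> = 1" using m[OF that] m1 by simp
      finally show ?thesis
        by (intro real_distribution.intro prob_spaceI real_distribution_axioms.intro) (auto simp: D_def)
    qed
    have ch: "char (D \<sigma>) t = (LINT x|lborel. iexp (t * x) * of_real (f \<sigma> x)) / of_real m" for \<sigma> t
    proof -
      have "char (D \<sigma>) t = (LINT x|lborel. (f \<sigma> x / m) *\<^sub>R iexp (t * x))"
        unfolding char_def D_def using m1 fnn by (intro integral_density) auto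
      also have "\<dots> = (LINT x|lborel. (iexp (t * x) * of_real (f \<sigma> x)) / of_real m)"
        by (intro Bochner_Integration.integral_cong refl) (simp add: scaleR_conv_of_real)
      finally show ?thesis by simp
    qed
    have "D 1 = D (- 1)"
      by (rule Levy_uniqueness) (use D in \<open>auto simp only: fun_eq_iff ch eq insert_iff\<close>)
    then have "AE x in lborel. ennreal (f 1 x / m) = ennreal (f (- 1) x / m)"
      unfolding D_def by (intro sigma_finite_measure.density_unique[OF lborel.sigma_finite_measure_axioms]) auto
    then show ?thesis
      by eventually_elim (use m1 fnn in \<open>auto simp: f_def max_def split: if_splits\<close>)
  qed
qed

text \<open>Conjugating h turns its transform at -t into the conjugate one at t, so the transforms
  of the real and imaginary part vanish as well.\<close>

lemma AE_zero_if_fourier_zero: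
  fixes h :: "real \<Rightarrow> complex"
  assumes h: "integrable lborel h"
    and zero: "\<And>t. (LINT x|lborel. iexp (t * x) * h x) = 0"
  shows "AE x in lborel. h x = 0"
proof -
  have [measurable]: "h \<in> borel_measurable borel" using h by auto
  have ei: "integrable lborel (\<lambda>x. iexp (t * x) * h x)" for t
    by (rule Bochner_Integration.integrable_bound[OF h]) (auto simp: norm_mult)
  have "integrable lborel (\<lambda>x. cnj (iexp (- t * x) * h x))" for t
    using ei[of "- t"] by (intro integrable_cnj)
  then have ec: "integrable lborel (\<lambda>x. iexp (t * x) * cnj (h x))" for t
    by (simp add: exp_cnj)
  have zc: "(LINT x|lborel. iexp (t * x) * cnj (h x)) = 0" for t
  proof -
    have "(LINT x|lborel. iexp (t * x) * cnj (h x)) = (LINT x|lborel. cnj (iexp (- t * x) * h x))"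
      by (simp add: exp_cnj)
    also have "\<dots> = cnj (LINT x|lborel. iexp (- t * x) * h x)"
      by (rule Bochner_Integration.integral_cnj)
    finally show ?thesis using zero[of "- t"] by simp
  qed
  have "AE x in lborel. Re (h x) = 0"
  proof (rule AE_zero_if_char_zero_real)
    show "(LINT x|lborel. iexp (t * x) * of_real (Re (h x))) = 0" for t
    proof -
      have "(\<lambda>x. iexp (t * x) * of_real (Re (h x))) = (\<lambda>x. (iexp (t * x) * h x + iexp (t * x) * cnj (h x)) / 2)"
        by (simp add: complex_add_cnj flip: distrib_left)
      then show ?thesis using ei[of t] ec[of t] zero[of t] zc[of t] by simp
    qed
  qed (use h in auto)
  moreover have "AE x in lborel. Im (h x) = 0"
  proof (rule AE_zero_if_char_zero_real)
    show "(LINT x|lborel. iexp (t * x) * of_real (Im (h x))) = 0" for t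
    proof -
      have "(\<lambda>x. iexp (t * x) * of_real (Im (h x))) = (\<lambda>x. (iexp (t * x) * h x - iexp (t * x) * cnj (h x)) / (2 * \<i>))"
        by (simp add: complex_diff_cnj mult.left_commute[of \<i>] flip: right_diff_distrib)
      then show ?thesis using ei[of t] ec[of t] zero[of t] zc[of t] by simp
    qed
  qed (use h in auto)
  ultimately show ?thesis by eventually_elim (simp add: complex_eq_iff)
qed

text \<open>A regular function need not be integrable, but its product with a Gaussian is. Testing
  against modulated Gaussians gives the whole Fourier transform of that product, and the Gaussian,
  having no zeros, can be divided out.\<close>

lemma regular_fun_unique:
  assumes g: "regular_fun g" and g': "regular_fun g'" and eq: "distr_of g = distr_of g'"
  shows "AE x in lborel. g x = g' x"
proof -
  define e where "e t = gauss_weight 1 0 1 (\<i> * of_real t)" for t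
  have e: "e t \<in> schwartz" for t unfolding e_def by (rule gauss_weight_schwartz) simp
  have e_eq: "e t x = exp (\<i> * of_real (t * x) + - (of_real x)\<^sup>2)" for t x
    by (simp add: e_def gauss_weight_def add_nonneg_eq_0_iff mult.assoc)
  have ee: "e t x = iexp (t * x) * e 0 x" for t x
    unfolding e_eq by (simp add: mult_exp_exp)
  have int: "integrable lborel (\<lambda>x. g x * e t x)" "integrable lborel (\<lambda>x. g' x * e t x)" for t
    using g g' e by (auto simp: regular_fun_def)
  have "(LINT x|lborel. g x * e t x) = (LINT x|lborel. g' x * e t x)" for t
    using fun_cong[OF eq, of "e t"] e by (simp add: distr_of_def)
  then have *: "(LINT x|lborel. g x * e t x - g' x * e t x) = 0" for t
    using int by simp
  have **: "g x * e t x - g' x * e t x = iexp (t * x) * (g x * e 0 x - g' x * e 0 x)" for t x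
    unfolding ee[of t x] by (simp add: algebra_simps)
  have z: "(LINT x|lborel. iexp (t * x) * (g x * e 0 x - g' x * e 0 x)) = 0" for t
  proof -
    have "(\<lambda>x. g x * e t x - g' x * e t x) = (\<lambda>x. iexp (t * x) * (g x * e 0 x - g' x * e 0 x))"
      by (rule ext) (rule **)
    with *[of t] show ?thesis by metis
  qed
  have "AE x in lborel. g x * e 0 x - g' x * e 0 x = 0"
    by (rule AE_zero_if_fourier_zero[OF _ z]) (use int in auto)
  moreover have "e 0 x \<noteq> 0" for x
    by (simp add: e_eq)
  ultimately show ?thesis by (simp flip: left_diff_distrib)
qed

section \<open>Functions determined by their integrals over half-lines\<close>

lemma AE_zero_if_tail_zero_real:
  fixes h :: "real \<Rightarrow> real"
  assumes h: "integrable lborel h"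
    and zero: "\<And>a. (LINT x:{a<..}|lborel. h x) = 0"
  shows "AE x in lborel. h x = 0"
proof (rule AE_zero_if_pos_neg_density_eq)
  show [measurable]: "h \<in> borel_measurable borel" using h by auto
  define f where "f \<sigma> x = max 0 (\<sigma> * h x)" for \<sigma> x
  have fi: "integrable lborel (f \<sigma>)" for \<sigma>
    unfolding f_def[abs_def] using h by (intro integrable_pos_part) auto
  have fa: "integrable lborel (\<lambda>x. indicator {a<..} x * f \<sigma> x)" for \<sigma> a
    using integrable_mult_indicator[OF _ fi[of \<sigma>], of "{a<..}"] by simp
  have [measurable]: "f \<sigma> \<in> borel_measurable borel" for \<sigma> unfolding f_def[abs_def] by measurable
  have e: "emeasure (density lborel (f \<sigma>)) {a<..} = ennreal (LINT x|lborel. indicator {a<..} x * f \<sigma> x)" for \<sigma> a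
  proof -
    have "emeasure (density lborel (f \<sigma>)) {a<..} = (\<integral>\<^sup>+ x. ennreal (indicator {a<..} x * f \<sigma> x) \<partial>lborel)"
      by (auto simp: emeasure_density intro!: nn_integral_cong split: split_indicator)
    also have "\<dots> = ennreal (LINT x|lborel. indicator {a<..} x * f \<sigma> x)"
      using fa by (intro nn_integral_eq_integral) (auto simp: f_def)
    finally show ?thesis .
  qed
  have eq: "(LINT x|lborel. indicator {a<..} x * f 1 x) = (LINT x|lborel. indicator {a<..} x * f (- 1) x)" for a
  proof -
    have "(\<lambda>x. indicator {a<..} x * h x) = (\<lambda>x. indicator {a<..} x * f 1 x - indicator {a<..} x * f (- 1) x)"
      by (auto simp: fun_eq_iff f_def split: split_indicator)
    then show ?thesis using zero[of a] fa[of a] by (simp add: set_lebesgue_integral_def)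
  qed
  have "density lborel (f 1) = density lborel (f (- 1))"
  proof (rule measure_eqI_lessThan)
    show "emeasure (density lborel (f 1)) {a<..} < \<infinity>" for a
      by (simp add: e)
    show "emeasure (density lborel (f 1)) {a<..} = emeasure (density lborel (f (- 1))) {a<..}" for a
      by (simp add: e eq)
  qed auto
  then show "density lborel (\<lambda>x. ennreal (max 0 (h x))) = density lborel (\<lambda>x. ennreal (max 0 (- h x)))"
    by (simp add: f_def[abs_def])
qed

text \<open>The integral over a half-line is right continuous in its end point, so rational end
  points suffice. In the application each end point brings its own null set, and only countably many
  can be discarded.\<close>

lemma AE_zero_if_tail_zero:
  fixes h :: "real \<Rightarrow> complex"
  assumes h: "integrable lborel h"
    and zero: "\<And>a. a \<in> \<rat> \<Longrightarrow> (LINT x:{a<..}|lborel. h x) = 0"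
  shows "AE x in lborel. h x = 0"
proof -
  have [measurable]: "h \<in> borel_measurable borel" using h by auto
  have hi: "integrable lborel (\<lambda>x. indicator {a<..} x *\<^sub>R h x)" for a :: real
    using integrable_mult_indicator[OF _ h] by simp
  have z: "(LINT x:{a<..}|lborel. h x) = 0" for a :: real
  proof -
    have "\<exists>r\<in>\<rat>. a < r \<and> r < a + 1 / Suc n" for n
      using Rats_dense_in_real[of a "a + 1 / Suc n"] by auto
    then obtain r where r: "\<And>n. r n \<in> \<rat>" "\<And>n. a < r n" "\<And>n. r n < a + 1 / Suc n" by metis
    have rl: "r \<longlonglongrightarrow> a"
    proof (rule tendsto_sandwich[where f = "\<lambda>_. a" and h = "\<lambda>n. a + 1 / Suc n"])
      show "(\<lambda>n. a + 1 / Suc n) \<longlonglongrightarrow> a" by real_asymp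
      show "\<forall>\<^sub>F n in sequentially. a \<le> r n" using r(2) by (simp add: less_imp_le)
      show "\<forall>\<^sub>F n in sequentially. r n \<le> a + 1 / Suc n" using r(3) by (intro always_eventually allI less_imp_le)
    qed simp
    have "(\<lambda>n. LINT x|lborel. indicator {r n<..} x *\<^sub>R h x) \<longlonglongrightarrow> (LINT x|lborel. indicator {a<..} x *\<^sub>R h x)"
    proof (rule integral_dominated_convergence[where w = "\<lambda>x. norm (h x)"])
      show "AE x in lborel. (\<lambda>n. indicator {r n<..} x *\<^sub>R h x) \<longlonglongrightarrow> indicator {a<..} x *\<^sub>R h x"
      proof (rule AE_I2)
        fix x
        have "eventually (\<lambda>n. indicator {r n<..} x *\<^sub>R h x = indicator {a<..} x *\<^sub>R h x) sequentially"
        proof (cases "x > a")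
          case True
          from order_tendstoD(2)[OF rl this] show ?thesis
            by eventually_elim (use True in auto)
        next
          case False
          then show ?thesis
            using r(2) by (intro always_eventually allI) (auto simp: indicator_def dest: less_trans)
        qed
        then show "(\<lambda>n. indicator {r n<..} x *\<^sub>R h x) \<longlonglongrightarrow> indicator {a<..} x *\<^sub>R h x"
          by (rule tendsto_eventually)
      qed
      show "AE x in lborel. norm (indicator {r n<..} x *\<^sub>R h x) \<le> norm (h x)" for n
        by (auto simp: indicator_def)
    qed (use h in auto)
    moreover have "(LINT x|lborel. indicator {r n<..} x *\<^sub>R h x) = 0" for n
      using zero[OF r(1)[of n]] by (simp add: set_lebesgue_integral_def)
    ultimately show ?thesis by (simp add: set_lebesgue_integral_def LIMSEQ_const_iff)
  qed
  have "AE x in lborel. Re (h x) = 0"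
  proof (rule AE_zero_if_tail_zero_real)
    show "(LINT x:{a<..}|lborel. Re (h x)) = 0" for a
      using integral_Re[OF hi[of a]] z[of a] by (simp add: set_lebesgue_integral_def)
  qed (use h in auto)
  moreover have "AE x in lborel. Im (h x) = 0"
  proof (rule AE_zero_if_tail_zero_real)
    show "(LINT x:{a<..}|lborel. Im (h x)) = 0" for a
      using integral_Im[OF hi[of a]] z[of a] by (simp add: set_lebesgue_integral_def)
  qed (use h in auto)
  ultimately show ?thesis by eventually_elim (simp add: complex_eq_iff)
qed

section \<open>Lebesgue spaces\<close>

text \<open>Young's inequality for f and g divided by their norms, integrated; a vanishing norm is
  treated separately, because then the product is 0 almost everywhere.\<close>

lemma Holder:
  fixes f g :: "'a \<Rightarrow> real"
  assumes pq: "p > 1" "q > 1" "1 / p + 1 / q = 1"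
    and [measurable]: "f \<in> borel_measurable M" "g \<in> borel_measurable M"
    and nn: "\<And>x. f x \<ge> 0" "\<And>x. g x \<ge> 0"
    and f: "integrable M (\<lambda>x. f x powr p)" and g: "integrable M (\<lambda>x. g x powr q)"
  shows "integrable M (\<lambda>x. f x * g x)"
    and "(LINT x|M. f x * g x) \<le> (LINT x|M. f x powr p) powr (1 / p) * (LINT x|M. g x powr q) powr (1 / q)"
proof -
  show fg: "integrable M (\<lambda>x. f x * g x)"
  proof (rule Bochner_Integration.integrable_bound)
    show "integrable M (\<lambda>x. f x powr p / p + g x powr q / q)" using f g by auto
    show "AE x in M. norm (f x * g x) \<le> norm (f x powr p / p + g x powr q / q)"
      using Youngs_inequality[OF pq] nn pq by (auto simp: abs_of_nonneg)
  qed measurable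
  define F where "F = (LINT x|M. f x powr p)"
  define G where "G = (LINT x|M. g x powr q)"
  have nn0: "F \<ge> 0" "G \<ge> 0" unfolding F_def G_def by simp_all
  show "(LINT x|M. f x * g x) \<le> F powr (1 / p) * G powr (1 / q)"
  proof (cases "F = 0 \<or> G = 0")
    case True
    have "AE x in M. f x * g x = 0"
    proof (cases "F = 0")
      case True
      then have "AE x in M. f x powr p = 0"
        using integral_nonneg_eq_0_iff_AE[OF f] by (simp add: F_def)
      then show ?thesis by eventually_elim simp
    next
      case False
      with True have "AE x in M. g x powr q = 0"
        using integral_nonneg_eq_0_iff_AE[OF g] by (simp add: G_def)
      then show ?thesis by eventually_elim simp
    qed
    then have "(LINT x|M. f x * g x) = (LINT x|M. 0)" by (intro integral_cong_AE) auto
    then show ?thesis by simp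
  next
    case False
    with nn0 have pos: "F > 0" "G > 0" by auto
    define A where "A = F powr (1 / p)"
    define B where "B = G powr (1 / q)"
    have AB: "A > 0" "B > 0" "A powr p = F" "B powr q = G"
      using pos pq by (auto simp: A_def B_def powr_powr)
    have "f x * g x \<le> A * B * (f x powr p / F / p + g x powr q / G / q)" for x
    proof -
      have "f x / A * (g x / B) \<le> (f x / A) powr p / p + (g x / B) powr q / q"
        using nn AB by (intro Youngs_inequality pq) auto
      also have "\<dots> = f x powr p / F / p + g x powr q / G / q"
        using nn AB by (simp add: powr_divide)
      finally show ?thesis using AB by (simp add: field_simps)
    qed
    then have "(LINT x|M. f x * g x) \<le> (LINT x|M. A * B * (f x powr p / F / p + g x powr q / G / q))"
      using f g fg by (intro integral_mono) auto
    also have "\<dots> = A * B * (F / F / p + G / G / q)"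
      using f g by (simp add: F_def G_def)
    also have "\<dots> = A * B" using pos pq by simp
    finally show ?thesis by (simp add: A_def B_def)
  qed
qed

lemma Lp_norm_nonneg [simp]: "Lp_norm p g \<ge> 0"
  by (simp add: Lp_norm_def)

lemma Lp_pairing:
  assumes pq: "p > 1" "q > 1" "1 / p + 1 / q = 1"
    and g: "g \<in> Lp p" and f: "f \<in> Lp q"
  shows "integrable lborel (\<lambda>x. g x * f x)"
    and "(LINT x|lborel. norm (g x) * norm (f x)) \<le> Lp_norm p g * Lp_norm q f"
    and "norm (LINT x|lborel. g x * f x) \<le> Lp_norm p g * Lp_norm q f"
proof -
  have [measurable]: "g \<in> borel_measurable borel" "f \<in> borel_measurable borel"
    using f g by (auto simp: Lp_def)
  have *: "integrable lborel (\<lambda>x. norm (g x) * norm (f x))"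
    "(LINT x|lborel. norm (g x) * norm (f x)) \<le> Lp_norm p g * Lp_norm q f"
    using Holder[OF pq, of "\<lambda>x. norm (g x)" lborel "\<lambda>x. norm (f x)"] f g by (auto simp: Lp_def Lp_norm_def)
  then show "(LINT x|lborel. norm (g x) * norm (f x)) \<le> Lp_norm p g * Lp_norm q f" by simp
  show i: "integrable lborel (\<lambda>x. g x * f x)"
    by (rule Bochner_Integration.integrable_bound[OF *(1)]) (auto simp: norm_mult)
  show "norm (LINT x|lborel. g x * f x) \<le> Lp_norm p g * Lp_norm q f"
    using integral_norm_bound[of lborel "\<lambda>x. g x * f x"] *(2) by (simp add: norm_mult)
qed

lemma Lp_regular_fun:
  assumes p: "p > 1" and g: "g \<in> Lp p" shows "regular_fun g"
proof -
  have "p / (p - 1) > 1" "1 / p + 1 / (p / (p - 1)) = 1" using p by (auto simp: field_simps)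
  then show ?thesis using g Lp_pairing(1)[OF p _ _ g schwartz_Lp]
    by (auto simp: regular_fun_def Lp_def)
qed

lemma Lp_norm_cong_AE:
  assumes "g \<in> borel_measurable borel" "g' \<in> borel_measurable borel" "AE x in lborel. g x = g' x"
  shows "Lp_norm p g = Lp_norm p g'"
proof -
  have "(LINT x|lborel. norm (g x) powr p) = (LINT x|lborel. norm (g' x) powr p)"
    using assms by (intro integral_cong_AE) (auto elim: eventually_mono)
  then show ?thesis by (simp add: Lp_norm_def)
qed

lemma density_of_regular:
  assumes "\<Lambda> \<in> regular_distr"
  shows "regular_fun (density_of \<Lambda>)" "distr_of (density_of \<Lambda>) = \<Lambda>"
proof -
  have "\<exists>g. regular_fun g \<and> distr_of g = \<Lambda>" using assms by (auto simp: regular_distr_def)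
  from someI_ex[OF this] show "regular_fun (density_of \<Lambda>)" "distr_of (density_of \<Lambda>) = \<Lambda>"
    by (auto simp: density_of_def)
qed

text \<open>\<open>bessel_norm\<close> is computed from the density that \<open>SOME\<close> picks.
  Almost everywhere uniqueness lets the given L^p representative take its place, and Holder's
  inequality does the rest.\<close>

lemma bessel_space_pairing:
  assumes pq: "p > 1" "q > 1" "1 / p + 1 / q = 1"
    and \<Lambda>: "\<Lambda> \<in> bessel_space s p" and f: "f \<in> schwartz"
  shows "norm (bessel_potential s \<Lambda> f) \<le> bessel_norm s p \<Lambda> * Lp_norm q f"
proof -
  from \<Lambda> obtain g where g: "g \<in> Lp p" "bessel_potential s \<Lambda> = distr_of g"
    by (auto simp: bessel_space_def)
  have r: "regular_fun g" by (rule Lp_regular_fun[OF pq(1) g(1)])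
  then have reg: "bessel_potential s \<Lambda> \<in> regular_distr" by (auto simp: regular_distr_def g(2))
  have "AE x in lborel. density_of (bessel_potential s \<Lambda>) x = g x"
    using density_of_regular[OF reg] r by (intro regular_fun_unique) (auto simp: g(2))
  then have "bessel_norm s p \<Lambda> = Lp_norm p g"
    unfolding bessel_norm_def using density_of_regular(1)[OF reg] r
    by (intro Lp_norm_cong_AE) (auto simp: regular_fun_def)
  then show ?thesis
    using Lp_pairing(3)[OF pq g(1) schwartz_Lp[OF f]] pq f by (simp add: g(2) distr_of_def)
qed

section \<open>The zero solution\<close>

text \<open>On the test function \<open>fourier F\<close> the inner \<open>inv_fourier\<close>
  cancels. All later computations with U(t) and the Bessel potential go through this
  identity.\<close>

lemma fourier_multiplier_fourier:
  assumes F: "F \<in> schwartz" and mF: "(\<lambda>\<xi>. m \<xi> * F \<xi>) \<in> schwartz"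
  shows "fourier_multiplier m \<Lambda> (fourier F) = \<Lambda> (fourier (\<lambda>\<xi>. m \<xi> * F \<xi>))"
  using assms
  by (simp add: fourier_multiplier_def inv_fourier_distr_def mult_distr_def fourier_distr_def
      fourier_schwartz schwartz_inversion)

lemma fourier_multiplier_zero [simp]: "fourier_multiplier m (\<lambda>_. 0) = (\<lambda>_. 0)"
  by (auto simp: fourier_multiplier_def inv_fourier_distr_def mult_distr_def fourier_distr_def)

lemma schrodinger_group_zero [simp]: "schrodinger_group t (\<lambda>_. 0) = (\<lambda>_. 0)"
  by (simp add: schrodinger_group_def)

lemma distr_of_eq_zero:
  assumes "AE x in lborel. g x = 0" shows "distr_of g = (\<lambda>_. 0)"
proof
  fix f
  have "(LINT x|lborel. g x * f x) = 0"
    by (rule integral_eq_zero_AE) (use assms in \<open>auto elim: eventually_mono\<close>)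
  then show "distr_of g f = 0" by (simp add: distr_of_def)
qed

lemma regular_fun_AE_zero:
  assumes [measurable]: "g \<in> borel_measurable borel" and "AE x in lborel. g x = 0"
  shows "regular_fun g"
proof -
  have "integrable lborel (\<lambda>x. g x * f x)" if "f \<in> schwartz" for f
  proof -
    have [measurable]: "f \<in> borel_measurable borel" using that by (rule schwartz_measurable)
    have "integrable lborel (\<lambda>x. g x * f x) \<longleftrightarrow> integrable lborel (\<lambda>x :: real. 0 :: complex)"
      using assms(2) by (intro integrable_cong_AE) (auto elim: eventually_mono)
    then show ?thesis by simp
  qed
  then show ?thesis by (auto simp: regular_fun_def)
qed

lemma zero_regular_distr [simp]: "(\<lambda>_. 0) \<in> regular_distr"
  using distr_of_eq_zero[of "\<lambda>_. 0"] regular_fun_AE_zero[of "\<lambda>_. 0"]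
  by (auto simp: regular_distr_def intro!: image_eqI[of _ _ "\<lambda>_. 0"])

text \<open>The density of the zero distribution is an arbitrary representative of 0, so the profile
  of the zero solution is a constant in time but perhaps not the zero function.\<close>

lemma density_of_zero: "AE x in lborel. density_of (\<lambda>_. 0) x = 0"
  using regular_fun_unique[OF density_of_regular(1)[OF zero_regular_distr] regular_fun_AE_zero[of "\<lambda>_. 0"]]
    density_of_regular(2)[OF zero_regular_distr] distr_of_eq_zero[of "\<lambda>_. 0"] by simp

lemma zero_tempered: "(\<lambda>_. 0) \<in> tempered"
  unfolding tempered_def by (auto intro!: exI[of _ 0])

text \<open>The identity defining w excludes a null set of x for each t. Keeping countably many t
  makes the null set common; then w(., x) integrates to 0 over a dense set of intervals and vanishes
  for almost every s.\<close>

lemma time_derivative_of_constant: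
  assumes w: "has_time_derivative T (\<lambda>_. g) w" and T: "T \<ge> 0"
  shows "AE s in lborel. s \<in> {0..T} \<longrightarrow> (AE x in lborel. w s x = 0)"
proof -
  have [measurable]: "(\<lambda>(s, x). w s x) \<in> borel_measurable (borel \<Otimes>\<^sub>M borel)"
    using w by (simp add: has_time_derivative_def)
  \<comment> \<open>T may be irrational, and the integral over all of [0, T] is required to pass
    from initial intervals to tails.\<close>
  define R where "R = insert T (\<rat> \<inter> {0..T})"
  have R: "countable R" "R \<subseteq> {0..T}" using T by (auto simp: R_def countable_rat)
  have "AE x in lborel. \<forall>t\<in>R. set_integrable lborel {0..t} (\<lambda>s. w s x) \<and> (LINT s:{0..t}|lborel. w s x) = 0"
    unfolding AE_ball_countable[OF R(1)] using w R(2) by (auto simp: has_time_derivative_def)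
  then have "AE x in lborel. AE s in lborel. s \<in> {0..T} \<longrightarrow> w s x = 0"
  proof eventually_elim
    fix x assume x: "\<forall>t\<in>R. set_integrable lborel {0..t} (\<lambda>s. w s x) \<and> (LINT s:{0..t}|lborel. w s x) = 0"
    define h where "h s = indicator {0..T} s *\<^sub>R w s x" for s
    have h: "integrable lborel h" "integral\<^sup>L lborel h = 0"
      using x by (auto simp: R_def h_def[abs_def] set_integrable_def set_lebesgue_integral_def)
    have "AE s in lborel. h s = 0"
    proof (rule AE_zero_if_tail_zero[OF h(1)])
      fix a :: real assume a: "a \<in> \<rat>"
      consider "a < 0" | "a \<in> {0..T}" | "a > T" by fastforce
      then show "(LINT s:{a<..}|lborel. h s) = 0"
      proof cases
        case 1
        have "(LINT s:{a<..}|lborel. h s) = integral\<^sup>L lborel h"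
          unfolding set_lebesgue_integral_def
          by (rule Bochner_Integration.integral_cong) (use 1 in \<open>auto simp: h_def split: split_indicator\<close>)
        then show ?thesis using h by simp
      next
        case 2
        with a have "a \<in> R" by (simp add: R_def)
        with x have ha: "set_integrable lborel {0..a} (\<lambda>s. w s x)" "(LINT s:{0..a}|lborel. w s x) = 0" by auto
        have "(LINT s:{a<..}|lborel. h s) = integral\<^sup>L lborel (\<lambda>s. h s - indicator {0..a} s *\<^sub>R w s x)"
          unfolding set_lebesgue_integral_def
          by (rule Bochner_Integration.integral_cong) (use 2 in \<open>auto simp: h_def split: split_indicator\<close>)
        also have "\<dots> = 0" using h ha by (simp add: set_integrable_def set_lebesgue_integral_def)
        finally show ?thesis .
      next
        case 3
        have "(LINT s:{a<..}|lborel. h s) = integral\<^sup>L lborel (\<lambda>s :: real. 0)"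
          unfolding set_lebesgue_integral_def
          by (rule Bochner_Integration.integral_cong) (use 3 in \<open>auto simp: h_def split: split_indicator\<close>)
        then show ?thesis by simp
      qed
    qed
    then show "AE s in lborel. s \<in> {0..T} \<longrightarrow> w s x = 0"
      by eventually_elim (auto simp: h_def)
  qed
  \<comment> \<open>The norm of w is taken in x at fixed s, so the two almost-everywhere quantifiers
    must change places.\<close>
  then have "AE s in lborel. AE x in lborel. s \<in> {0..T} \<longrightarrow> w s x = 0"
    by (subst lborel_pair.AE_commute) measurable
  then show ?thesis by eventually_elim auto
qed

lemma time_deriv_has_time_derivative:
  assumes "has_time_derivative T v w" shows "has_time_derivative T v (time_deriv T v)"
  unfolding time_deriv_def using assms by (rule someI[where P = "has_time_derivative T v"])

lemma Lp_AE_zero: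
  assumes [measurable]: "g \<in> borel_measurable borel" and z: "AE x in lborel. g x = 0"
  shows "g \<in> Lp p" "Lp_norm p g = 0"
proof -
  have "integrable lborel (\<lambda>x. norm (g x) powr p) \<longleftrightarrow> integrable lborel (\<lambda>x :: real. 0 :: real)"
    using z by (intro integrable_cong_AE) (auto elim: eventually_mono)
  then show "g \<in> Lp p" by (simp add: Lp_def)
  have "(LINT x|lborel. norm (g x) powr p) = 0"
    by (rule integral_eq_zero_AE) (use z in \<open>auto elim: eventually_mono\<close>)
  then show "Lp_norm p g = 0" by (simp add: Lp_norm_def)
qed

text \<open>Together with \<open>zero_nls_solution\<close> this makes 0 a competitor in the
  uniqueness clause, so that the solution map must send 0 to 0. The norm refers to the chosen
  \<open>time_deriv\<close>, hence the claim about arbitrary time derivatives above.\<close>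

lemma zero_Y_space:
  assumes T: "T \<ge> 0"
  shows "(\<lambda>_ _. 0) \<in> Y_space p q \<theta> T"
proof -
  define Z where "Z = density_of (\<lambda>_. 0)"
  have Zm [measurable]: "Z \<in> borel_measurable borel"
    using density_of_regular(1)[OF zero_regular_distr] by (simp add: Z_def regular_fun_def)
  have Z0: "AE x in lborel. Z x = 0" unfolding Z_def by (rule density_of_zero)
  have prof: "profile (\<lambda>_ _. 0) = (\<lambda>_. Z)" by (simp add: profile_def Z_def fun_eq_iff)
  have "has_time_derivative T (\<lambda>_. Z) (\<lambda>_ _. 0)"
    by (auto simp: has_time_derivative_def set_integrable_def set_lebesgue_integral_def)
  define w where "w = time_deriv T (\<lambda>_. Z)"
  have w: "has_time_derivative T (\<lambda>_. Z) w"
    unfolding w_def by (rule time_deriv_has_time_derivative) fact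
  then have [measurable]: "(\<lambda>(s, x). w s x) \<in> borel_measurable (borel \<Otimes>\<^sub>M borel)"
    by (simp add: has_time_derivative_def)
  have w0: "AE s in lborel. s \<in> {0..T} \<longrightarrow> w s \<in> Lp p \<and> Lp_norm p (w s) = 0"
    using time_derivative_of_constant[OF w T]
    by eventually_elim (auto intro!: Lp_AE_zero)
  have "integrable lborel (\<lambda>s. indicator {0..T} s *\<^sub>R (s powr \<theta> * Lp_norm p (w s)) powr q)
      \<longleftrightarrow> integrable lborel (\<lambda>s :: real. 0 :: real)"
  proof (rule integrable_cong_AE)
    show "(\<lambda>s. indicator {0..T} s *\<^sub>R (s powr \<theta> * Lp_norm p (w s)) powr q) \<in> borel_measurable lborel"
      unfolding Lp_norm_def by measurable
    show "AE s in lborel. indicator {0..T} s *\<^sub>R (s powr \<theta> * Lp_norm p (w s)) powr q = 0"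
      using w0 by eventually_elim (auto simp: indicator_def)
  qed simp
  then have "(\<lambda>_. Z) \<in> X_space p q \<theta> T"
    using w w0 Lp_AE_zero(1)[OF Zm Z0]
    by (auto simp: X_space_def Xt_space_def w_def[symmetric] set_integrable_def elim: eventually_mono)
  then show ?thesis
    by (auto simp: Y_space_def prof zero_tempered)
qed

lemma zero_nls_solution: "nls_solution T (\<lambda>_. 0) (\<lambda>_ _. 0)"
proof -
  define Z where "Z = density_of (\<lambda>_. 0)"
  have Zm [measurable]: "Z \<in> borel_measurable borel"
    using density_of_regular(1)[OF zero_regular_distr] by (simp add: Z_def regular_fun_def)
  have "AE x in lborel. Z x = 0" unfolding Z_def by (rule density_of_zero)
  then have c0: "AE x in lborel. cube Z x = 0" by eventually_elim (simp add: cube_def)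
  have [measurable]: "cube Z \<in> borel_measurable borel" unfolding cube_def[abs_def] by measurable
  have "regular_fun (cube Z)" "cubic (\<lambda>_. 0) = (\<lambda>_. 0)"
    using c0 by (auto simp: cubic_def Z_def[symmetric] intro!: regular_fun_AE_zero distr_of_eq_zero)
  then show ?thesis
    using distr_of_eq_zero[of "\<lambda>_. 0"]
    by (auto simp: nls_solution_def cubic_defined_def Z_def set_integrable_def set_lebesgue_integral_def)
qed

lemma zero_Lp_ball: "M \<ge> 0 \<Longrightarrow> (\<lambda>_. 0) \<in> Lp_ball p M"
  using Lp_AE_zero[of "\<lambda>_. 0" p] by (simp add: Lp_ball_def)

text \<open>The two functions have the same set of time derivatives, so \<open>SOME\<close> returns
  the same one for both.\<close>

lemma X_norm_cong:
  assumes "\<And>t. t \<in> {0..T} \<Longrightarrow> v t = v' t" "T \<ge> 0"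
  shows "X_norm p q \<theta> T v = X_norm p q \<theta> T v'"
proof -
  have "has_time_derivative T v = has_time_derivative T v'"
    using assms by (auto simp: has_time_derivative_def fun_eq_iff)
  then show ?thesis using assms by (simp add: X_norm_def Xt_norm_def time_deriv_def)
qed

section \<open>Stability of the profile under the pairing\<close>

text \<open>The difference is the time integral of w paired with k. Holder in x leaves the norm of
  w(s); the weight costs s^(-\<theta>) \<le> t^(-\<theta>), as -\<theta> = 1 - 2/p is positive;
  Holder in time on [0, t] adds t^(1/p). The exponents sum to 1 - 1/p.\<close>

lemma X_space_pairing:
  assumes p: "p > 2" and q: "q = p / (p - 1)" and \<theta>: "\<theta> = - (1 - 2 / p)"
    and v: "v \<in> X_space p q \<theta> T" and t: "t \<in> {0..T}" and k: "k \<in> Lp q"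
    and int: "integrable lborel (\<lambda>x. v t x * k x)" "integrable lborel (\<lambda>x. v 0 x * k x)"
  shows "norm ((LINT x|lborel. v t x * k x) - (LINT x|lborel. v 0 x * k x))
    \<le> t powr (1 - 1 / p) * Xt_norm p q \<theta> T v * Lp_norm q k"
proof -
  have pq: "p > 1" "q > 1" "1 / p + 1 / q = 1" unfolding q using p by (auto simp: field_simps)
  define w where "w = time_deriv T v"
  have w: "has_time_derivative T v w"
    using v time_deriv_has_time_derivative by (auto simp: X_space_def Xt_space_def w_def)
  have wm [measurable]: "(\<lambda>(s, x). w s x) \<in> borel_measurable (borel \<Otimes>\<^sub>M borel)"
    using w by (simp add: has_time_derivative_def)
  have [measurable]: "k \<in> borel_measurable borel" using k by (simp add: Lp_def)
  define K where "K = Lp_norm q k"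
  define y where "y s = indicator {0..T} s * (s powr \<theta> * Lp_norm p (w s))" for s
  have ynn: "y s \<ge> 0" for s by (auto simp: y_def indicator_def)
  have wp: "AE s in lborel. s \<in> {0..T} \<longrightarrow> w s \<in> Lp p"
    using v by (auto simp: X_space_def Xt_space_def w_def)
  have y_eq: "indicator {0..T} s * (s powr \<theta> * Lp_norm p (w s)) powr q = y s powr q" for s
    by (auto simp: y_def indicator_def)
  have yq: "integrable lborel (\<lambda>s. y s powr q)"
    using v by (simp add: X_space_def Xt_space_def w_def[symmetric] set_integrable_def y_eq)
  have N: "Xt_norm p q \<theta> T v = (LINT s|lborel. y s powr q) powr (1 / q)"
    by (simp add: Xt_norm_def w_def[symmetric] set_lebesgue_integral_def y_eq)
  have [measurable]: "y \<in> borel_measurable borel"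
    unfolding y_def[abs_def] Lp_norm_def by measurable
  have Hy: "integrable lborel (\<lambda>s. indicator {0..t} s * y s)"
    "(LINT s|lborel. indicator {0..t} s * y s) \<le> t powr (1 / p) * Xt_norm p q \<theta> T v"
  proof -
    have i: "(\<lambda>s. indicator {0..t} s powr p) = (indicator {0..t} :: real \<Rightarrow> real)"
      by (auto simp: indicator_def)
    have "integrable lborel (\<lambda>s. indicator {0..t} s powr p :: real)"
      unfolding i using t by (intro integrable_real_indicator) (auto simp: emeasure_lborel_Icc)
    from Holder[OF pq _ _ _ _ this yq] ynn
    show "integrable lborel (\<lambda>s. indicator {0..t} s * y s)"
      "(LINT s|lborel. indicator {0..t} s * y s) \<le> t powr (1 / p) * Xt_norm p q \<theta> T v"
      using t unfolding N i by simp_all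
  qed
  have AEx: "AE x in lborel. set_integrable lborel {0..t} (\<lambda>s. w s x) \<and>
      v t x = v 0 x + (LINT s:{0..t}|lborel. w s x)"
    using w t by (simp add: has_time_derivative_def)
  \<comment> \<open>Nonnegative integrals allow the order of integration to be exchanged before
    joint integrability is known.\<close>
  have "ennreal (norm ((LINT x|lborel. v t x * k x) - (LINT x|lborel. v 0 x * k x)))
      = ennreal (norm (LINT x|lborel. v t x * k x - v 0 x * k x))"
    using int by simp
  also have "\<dots> \<le> (\<integral>\<^sup>+ x. ennreal (norm (v t x * k x - v 0 x * k x)) \<partial>lborel)"
    using int by (intro integral_norm_bound_ennreal) auto
  also have "\<dots> \<le> (\<integral>\<^sup>+ x. \<integral>\<^sup>+ s. ennreal (indicator {0..t} s * (norm (w s x) * norm (k x))) \<partial>lborel \<partial>lborel)"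
  proof (rule nn_integral_mono_AE)
    show "AE x in lborel. ennreal (norm (v t x * k x - v 0 x * k x))
        \<le> (\<integral>\<^sup>+ s. ennreal (indicator {0..t} s * (norm (w s x) * norm (k x))) \<partial>lborel)"
      using AEx
    proof eventually_elim
      fix x assume x: "set_integrable lborel {0..t} (\<lambda>s. w s x) \<and> v t x = v 0 x + (LINT s:{0..t}|lborel. w s x)"
      then have "v t x * k x - v 0 x * k x = (LINT s|lborel. indicator {0..t} s *\<^sub>R w s x) * k x"
        by (simp add: set_lebesgue_integral_def distrib_right)
      also have "\<dots> = (LINT s|lborel. (indicator {0..t} s *\<^sub>R w s x) * k x)"
        by (rule integral_mult_left_zero[symmetric])
      also have "ennreal (norm \<dots>) \<le> (\<integral>\<^sup>+ s. ennreal (norm ((indicator {0..t} s *\<^sub>R w s x) * k x)) \<partial>lborel)"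
        using x by (intro integral_norm_bound_ennreal integrable_mult_left) (simp add: set_integrable_def)
      also have "\<dots> = (\<integral>\<^sup>+ s. ennreal (indicator {0..t} s * (norm (w s x) * norm (k x))) \<partial>lborel)"
        by (intro nn_integral_cong) (auto simp: norm_mult indicator_def)
      finally show "ennreal (norm (v t x * k x - v 0 x * k x))
        \<le> (\<integral>\<^sup>+ s. ennreal (indicator {0..t} s * (norm (w s x) * norm (k x))) \<partial>lborel)" .
    qed
  qed
  also have "\<dots> = (\<integral>\<^sup>+ s. \<integral>\<^sup>+ x. ennreal (indicator {0..t} s * (norm (w s x) * norm (k x))) \<partial>lborel \<partial>lborel)"
    by (rule lborel_pair.Fubini') measurable
  also have "\<dots> \<le> (\<integral>\<^sup>+ s. ennreal (t powr (- \<theta>) * K * (indicator {0..t} s * y s)) \<partial>lborel)"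
  proof (rule nn_integral_mono_AE)
    show "AE s in lborel. (\<integral>\<^sup>+ x. ennreal (indicator {0..t} s * (norm (w s x) * norm (k x))) \<partial>lborel)
        \<le> ennreal (t powr (- \<theta>) * K * (indicator {0..t} s * y s))"
      using wp AE_lborel_singleton[of 0]
    proof eventually_elim
      \<comment> \<open>At s = 0 both powers s^\<theta> and s^(-\<theta>) are 0 in HOL and do not
        multiply to 1, so this point is left out.\<close>
      fix s :: real assume s: "s \<in> {0..T} \<longrightarrow> w s \<in> Lp p" "s \<noteq> 0"
      show "(\<integral>\<^sup>+ x. ennreal (indicator {0..t} s * (norm (w s x) * norm (k x))) \<partial>lborel)
        \<le> ennreal (t powr (- \<theta>) * K * (indicator {0..t} s * y s))"
      proof (cases "s \<in> {0..t}")
        case True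
        with s t have sT: "s > 0" "s \<le> t" "w s \<in> Lp p" "s \<in> {0..T}" by auto
        have "integrable lborel (\<lambda>x. norm (w s x * k x))"
          using Lp_pairing(1)[OF pq sT(3) k] by (rule integrable_norm)
        then have "(\<integral>\<^sup>+ x. ennreal (norm (w s x) * norm (k x)) \<partial>lborel)
            = ennreal (LINT x|lborel. norm (w s x) * norm (k x))"
          by (intro nn_integral_eq_integral) (auto simp: norm_mult)
        also have "\<dots> \<le> ennreal (Lp_norm p (w s) * K)"
          unfolding K_def by (intro ennreal_leI Lp_pairing(2)[OF pq sT(3) k])
        also have "Lp_norm p (w s) = s powr (- \<theta>) * (s powr \<theta> * Lp_norm p (w s))"
          using sT by (simp add: mult.assoc[symmetric] powr_add[symmetric])
        also have "ennreal (\<dots> * K) \<le> ennreal (t powr (- \<theta>) * (s powr \<theta> * Lp_norm p (w s)) * K)"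
          using sT p by (intro ennreal_leI mult_right_mono powr_mono2) (auto simp: K_def \<theta>)
        finally show ?thesis using True sT by (simp add: y_def mult_ac)
      qed simp
    qed
  qed
  also have "\<dots> = ennreal (LINT s|lborel. t powr (- \<theta>) * K * (indicator {0..t} s * y s))"
    using ynn by (intro nn_integral_eq_integral integrable_mult_right Hy) (auto simp: K_def)
  also have "\<dots> \<le> ennreal (t powr (- \<theta>) * K * (t powr (1 / p) * Xt_norm p q \<theta> T v))"
    using Hy(2) by (intro ennreal_leI) (simp add: K_def mult_left_mono)
  also have "t powr (- \<theta>) * K * (t powr (1 / p) * Xt_norm p q \<theta> T v)
      = (t powr (- \<theta>) * t powr (1 / p)) * Xt_norm p q \<theta> T v * K" by simp
  also have "t powr (- \<theta>) * t powr (1 / p) = t powr (1 - 1 / p)"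
    using p by (simp add: powr_add[symmetric] \<theta> field_simps)
  finally show ?thesis
    by (subst (asm) ennreal_le_iff) (auto simp: K_def N)
qed

section \<open>Consequence of well-posedness for the free evolution\<close>

text \<open>The extremal function in Holder's inequality for k, normalised in L^p when q is the
  conjugate exponent and k has positive norm. Where k vanishes the last factor makes the value 0,
  even for q < 2.\<close>

definition dual_fun :: "real \<Rightarrow> (real \<Rightarrow> complex) \<Rightarrow> real \<Rightarrow> complex" where
  "dual_fun q k x = of_real (Lp_norm q k powr (1 - q) * norm (k x) powr (q - 2)) * cnj (k x)"

lemma dual_fun:
  assumes p: "p > 1" and q: "q = p / (p - 1)" and k: "k \<in> Lp q" and K: "Lp_norm q k > 0"
  shows "dual_fun q k \<in> Lp p" "Lp_norm p (dual_fun q k) = 1"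
    "(LINT x|lborel. dual_fun q k x * k x) = of_real (Lp_norm q k)"
proof -
  define K where "K = Lp_norm q k"
  have K0: "K > 0" using K by (simp add: K_def)
  have q1: "q > 1" "(q - 1) * p = q" "(1 - q) * p = - q" unfolding q using p by (auto simp: field_simps)
  have [measurable]: "k \<in> borel_measurable borel" using k by (simp add: Lp_def)
  have ki: "integrable lborel (\<lambda>x. norm (k x) powr q)" using k by (simp add: Lp_def)
  have Kq: "(LINT x|lborel. norm (k x) powr q) = K powr q"
    using q1 unfolding K_def Lp_norm_def by (simp add: powr_powr)
  have n: "norm (dual_fun q k x) = K powr (1 - q) * norm (k x) powr (q - 1)" for x
  proof (cases "k x = 0")
    case False
    then have "norm (k x) powr (q - 1) = norm (k x) powr (q - 2) * norm (k x) powr 1"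
      unfolding powr_add[symmetric] by simp
    then show ?thesis using False by (simp add: dual_fun_def norm_mult K_def)
  qed (simp add: dual_fun_def)
  have np: "norm (dual_fun q k x) powr p = K powr (- q) * norm (k x) powr q" for x
    using K0 unfolding n by (simp only: powr_mult powr_powr q1 powr_ge_zero)
  have "cnj \<in> borel_measurable borel"
    by (intro borel_measurable_continuous_onI continuous_intros)
  then have [measurable]: "(\<lambda>x. cnj (k x)) \<in> borel_measurable borel"
    by (rule measurable_compose[rotated]) measurable
  have m: "dual_fun q k \<in> borel_measurable borel" unfolding dual_fun_def[abs_def] by measurable
  then show "dual_fun q k \<in> Lp p" using ki by (simp add: Lp_def np)
  show "Lp_norm p (dual_fun q k) = 1"
    using K0 by (simp add: Lp_norm_def np Kq powr_minus)
  have pk: "dual_fun q k x * k x = of_real (K powr (1 - q) * norm (k x) powr q)" for x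
  proof (cases "k x = 0")
    case False
    then have "norm (k x) powr q = norm (k x) powr (q - 2) * (norm (k x))\<^sup>2"
      by (simp add: powr_add[symmetric] flip: powr_numeral)
    moreover have "cnj (k x) * k x = of_real ((norm (k x))\<^sup>2)"
      unfolding complex_norm_square by (rule mult.commute)
    ultimately show ?thesis by (simp add: dual_fun_def K_def mult.assoc)
  qed (simp add: dual_fun_def)
  have "(LINT x|lborel. dual_fun q k x * k x) = of_real (LINT x|lborel. K powr (1 - q) * norm (k x) powr q)"
    unfolding pk by (rule integral_complex_of_real)
  also have "(LINT x|lborel. K powr (1 - q) * norm (k x) powr q) = K"
    using K0 by (simp add: Kq powr_add[symmetric])
  finally show "(LINT x|lborel. dual_fun q k x * k x) = of_real (Lp_norm q k)" by (simp add: K_def)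
qed

text \<open>The data are dual to \<open>U(t)\<langle>\<partial>\<^sub>x\<rangle>\<^sup>s f\<close>, where \<open>f\<close> is the Fourier transform of \<open>F\<close>. For small \<open>t\<close> the Duhamel
  term is then at most half of the linear one, whatever the nonlinearity.\<close>
lemma smoothing_bound:
  fixes p s C T :: real and S :: "(real \<Rightarrow> complex) \<Rightarrow> real \<Rightarrow> distr"
  assumes p: "p > 2" and q: "q = p / (p - 1)"
    and S: "lwp_solution_map p M T S" and M: "M \<ge> 1"
    and cont: "\<forall>\<phi>\<in>Lp_ball p M. S \<phi> \<in> bessel_continuous s p T"
    and C: "C > 0"
    and lip: "\<forall>\<phi>1\<in>Lp_ball p M. \<forall>\<phi>2\<in>Lp_ball p M.
      (SUP t\<in>{0..T}. ennreal (bessel_norm s p (distr_diff (S \<phi>1 t) (S \<phi>2 t))))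
        \<le> ennreal (C * Lp_norm p (\<lambda>x. \<phi>1 x - \<phi>2 x))"
  shows "\<exists>t>0. \<forall>F G. F \<in> schwartz \<longrightarrow>
    (\<lambda>\<xi>. of_real ((1 + \<xi>\<^sup>2) powr (s / 2)) * F \<xi>) \<in> schwartz \<longrightarrow>
    G = (\<lambda>\<xi>. exp (- \<i> * of_real (t * \<xi>\<^sup>2)) * (of_real ((1 + \<xi>\<^sup>2) powr (s / 2)) * F \<xi>)) \<longrightarrow>
    G \<in> schwartz \<longrightarrow> Lp_norm q (fourier G) \<le> 2 * C * Lp_norm q (fourier F)"
proof -
  define \<theta> where "\<theta> = - (1 - 2 / p)"
  have pq: "p > 1" "q > 1" "1 / p + 1 / q = 1" unfolding q using p by (auto simp: field_simps)
  have T: "T > 0" using S by (simp add: lwp_solution_map_def Let_def)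
  note S' = S[unfolded lwp_solution_map_def Let_def, folded q \<theta>_def]
  have sol: "S \<phi> \<in> Y_space p q \<theta> T" "nls_solution T \<phi> (S \<phi>)" if "\<phi> \<in> Lp_ball p M" for \<phi>
    using S' that by blast+
  have zb: "(\<lambda>_. 0) \<in> Lp_ball p M" using M by (intro zero_Lp_ball) simp
  \<comment> \<open>Uniqueness in \<open>Y_space\<close> compares the solution with data 0 to the
    zero function.\<close>
  have S0: "S (\<lambda>_. 0) t = (\<lambda>_. 0)" if "t \<in> {0..T}" for t
  proof -
    have "\<forall>u\<in>Y_space p q \<theta> T. nls_solution T (\<lambda>_. 0) u \<longrightarrow> (\<forall>t\<in>{0..T}. u t = S (\<lambda>_. 0) t)"
      using S' zb by blast
    from bspec[OF this zero_Y_space] zero_nls_solution T that show ?thesis by simp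
  qed
  have bn: "bessel_norm s p (S \<phi> t) \<le> C * Lp_norm p \<phi>" if \<phi>: "\<phi> \<in> Lp_ball p M" and t: "t \<in> {0..T}" for \<phi> t
  proof -
    have "ennreal (bessel_norm s p (distr_diff (S \<phi> t) (S (\<lambda>_. 0) t))) \<le> ennreal (C * Lp_norm p \<phi>)"
      using order_trans[OF SUP_upper bspec[OF bspec[OF lip \<phi>] zb], OF t] by simp
    then show ?thesis using C by (subst (asm) ennreal_le_iff) (auto simp: S0[OF t] distr_diff_def)
  qed
  obtain L where L: "\<And>\<phi>. \<phi> \<in> Lp_ball p M \<Longrightarrow>
      Y_norm p q \<theta> T (\<lambda>t. distr_diff (S \<phi> t) (S (\<lambda>_. 0) t)) \<le> L * Lp_norm p \<phi>"
  proof -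
    obtain L where "\<forall>\<phi>1\<in>Lp_ball p M. \<forall>\<phi>2\<in>Lp_ball p M.
          Y_norm p q \<theta> T (\<lambda>t. distr_diff (S \<phi>1 t) (S \<phi>2 t)) \<le> L * Lp_norm p (\<lambda>x. \<phi>1 x - \<phi>2 x)"
      using S' by blast
    from bspec[OF bspec[OF this] zb] show ?thesis by (intro that[of L]) simp
  qed
  have Xn: "Xt_norm p q \<theta> T (profile (S \<phi>)) \<le> \<bar>L\<bar> * Lp_norm p \<phi>" if \<phi>: "\<phi> \<in> Lp_ball p M" for \<phi>
  proof -
    have "Y_norm p q \<theta> T (\<lambda>t. distr_diff (S \<phi> t) (S (\<lambda>_. 0) t)) = X_norm p q \<theta> T (profile (S \<phi>))"
      unfolding Y_norm_def using T
      by (intro X_norm_cong) (auto simp: profile_def S0 distr_diff_def)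
    then have "Xt_norm p q \<theta> T (profile (S \<phi>)) \<le> L * Lp_norm p \<phi>"
      using L[OF \<phi>] Lp_norm_nonneg[of p "profile (S \<phi>) 0"] unfolding X_norm_def by linarith
    also have "\<dots> \<le> \<bar>L\<bar> * Lp_norm p \<phi>" by (intro mult_right_mono) auto
    finally show ?thesis .
  qed
  \<comment> \<open>Any t with t^(1-1/p) \<le> \<epsilon> makes the Duhamel factor t^(1-1/p) |L| at
    most 1/2; the +1 covers L = 0. The time t below depends on L, p and T alone, so it is the same
    for all F and G.\<close>
  define \<epsilon> where "\<epsilon> = 1 / (2 * (\<bar>L\<bar> + 1))"
  have \<epsilon>: "\<epsilon> > 0" "\<epsilon> * \<bar>L\<bar> \<le> 1 / 2" by (auto simp: \<epsilon>_def field_simps)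
  define t where "t = min T (\<epsilon> powr (1 / (1 - 1 / p)))"
  have t: "t > 0" "t \<in> {0..T}" using T \<epsilon> by (auto simp: t_def)
  have "t powr (1 - 1 / p) \<le> (\<epsilon> powr (1 / (1 - 1 / p))) powr (1 - 1 / p)"
    using t p by (intro powr_mono2) (auto simp: t_def)
  also have "\<dots> = \<epsilon>" using p \<epsilon> by (simp add: powr_powr)
  finally have te: "t powr (1 - 1 / p) * \<bar>L\<bar> \<le> 1 / 2"
    using \<epsilon>(2) mult_right_mono[of "t powr (1 - 1 / p)" \<epsilon> "\<bar>L\<bar>"] by linarith
  show ?thesis
  proof (intro exI conjI allI impI)
    show "t > 0" by fact
    fix F G :: "real \<Rightarrow> complex"
    define mF where "mF = (\<lambda>\<xi>. of_real ((1 + \<xi>\<^sup>2) powr (s / 2)) * F \<xi>)"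
    assume F: "F \<in> schwartz" and "(\<lambda>\<xi>. of_real ((1 + \<xi>\<^sup>2) powr (s / 2)) * F \<xi>) \<in> schwartz"
      and "G = (\<lambda>\<xi>. exp (- \<i> * of_real (t * \<xi>\<^sup>2)) * (of_real ((1 + \<xi>\<^sup>2) powr (s / 2)) * F \<xi>))"
      and G: "G \<in> schwartz"
    then have mF: "mF \<in> schwartz" and G_eq: "G = (\<lambda>\<xi>. exp (- \<i> * of_real (t * \<xi>\<^sup>2)) * mF \<xi>)"
      by (auto simp: mF_def)
    define k where "k = fourier G"
    have k: "k \<in> schwartz" "k \<in> Lp q"
      using G pq by (auto simp: k_def fourier_schwartz intro!: schwartz_Lp)
    define K where "K = Lp_norm q k"
    show "Lp_norm q (fourier G) \<le> 2 * C * Lp_norm q (fourier F)"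
    proof (cases "K = 0")
      case True
      then show ?thesis using C by (simp add: K_def k_def)
    next
      case False
      then have K: "K > 0" using Lp_norm_nonneg[of q k] unfolding K_def by linarith
      define \<phi> where "\<phi> = dual_fun q k"
      have \<phi>: "\<phi> \<in> Lp p" "Lp_norm p \<phi> = 1" "(LINT x|lborel. \<phi> x * k x) = of_real K"
        using dual_fun[OF pq(1) q k(2)] K by (auto simp: \<phi>_def K_def)
      have ball: "\<phi> \<in> Lp_ball p M" using \<phi> M by (simp add: Lp_ball_def)
      define u where "u = S \<phi>"
      define v where "v = profile u"
      have u: "u \<in> Y_space p q \<theta> T" "nls_solution T \<phi> u" using sol[OF ball] by (auto simp: u_def)
      have reg: "regular_fun (v r)" "distr_of (v r) = schrodinger_group (- r) (u r)" if "r \<in> {0..T}" for r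
        using density_of_regular u(1) that by (auto simp: Y_space_def v_def profile_def)
      have vint: "integrable lborel (\<lambda>x. v r x * k x)" if "r \<in> {0..T}" for r
        using reg(1)[OF that] k(1) by (auto simp: regular_fun_def)
      have vk: "(LINT x|lborel. v r x * k x) = schrodinger_group (- r) (u r) k" if "r \<in> {0..T}" for r
        using reg(2)[OF that, symmetric] k(1) by (simp add: distr_of_def)
      \<comment> \<open>The phase in \<open>G\<close> is undone by U(-t); the weight that remains is
        then moved onto u(t) as a Bessel potential.\<close>
      have "(LINT x|lborel. v t x * k x) = u t (fourier mF)"
      proof -
        have e: "(\<lambda>\<xi>. exp (- \<i> * of_real (- t * \<xi>\<^sup>2)) * G \<xi>) = mF"
          by (simp add: G_eq mult_exp_exp flip: mult.assoc)
        show ?thesis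
          unfolding vk[OF t(2)] unfolding schrodinger_group_def k_def
          using fourier_multiplier_fourier[OF G, of "\<lambda>\<xi>. exp (- \<i> * of_real (- t * \<xi>\<^sup>2))"] mF
          unfolding e by simp
      qed
      also have "u t (fourier mF) = bessel_potential s (u t) (fourier F)"
        unfolding bessel_potential_def mF_def
        by (rule fourier_multiplier_fourier[symmetric, OF F]) (use mF in \<open>simp add: mF_def\<close>)
      also have "norm \<dots> \<le> bessel_norm s p (u t) * Lp_norm q (fourier F)"
        using bspec[OF cont ball] t(2) F
        by (intro bessel_space_pairing pq fourier_schwartz) (auto simp: bessel_continuous_def u_def)
      also have "\<dots> \<le> C * Lp_norm q (fourier F)"
        using bn[OF ball t(2)] \<phi>(2) by (intro mult_right_mono) (auto simp: u_def)
      finally have 1: "norm (LINT x|lborel. v t x * k x) \<le> C * Lp_norm q (fourier F)" .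
      \<comment> \<open>The initial value enters through the integral equation at t = 0, where the
        Duhamel integral runs over a single point. This yields u(0) and \<phi> with equal pairings
        against k.\<close>
      have 2: "(LINT x|lborel. v 0 x * k x) = of_real K"
      proof -
        have id: "schrodinger_group 0 \<Lambda> k = \<Lambda> k" for \<Lambda>
          using fourier_multiplier_fourier[OF G, of "\<lambda>\<xi>. exp (- \<i> * of_real (0 * \<xi>\<^sup>2))" \<Lambda>] G
          by (simp add: schrodinger_group_def k_def)
        have "AE r in lebesgue. (r :: real) \<noteq> 0"
          using AE_completion[OF AE_lborel_singleton[of "0 :: real"]] by simp
        then have "AE r in lebesgue. indicator {0..0} r *\<^sub>R schrodinger_group (0 - r) (cubic (u r)) k = 0"
          by eventually_elim simp
        then have "(LINT r:{0..0}|lebesgue. schrodinger_group (0 - r) (cubic (u r)) k) = 0"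
          unfolding set_lebesgue_integral_def by (rule integral_eq_zero_AE)
        then have "u 0 k = distr_of \<phi> k"
          using u(2) k(1) T id[of "distr_of \<phi>"] by (auto simp: nls_solution_def)
        then show ?thesis
          using vk[of 0] T id[of "u 0"] k(1) \<phi>(3) by (simp add: distr_of_def)
      qed
      have "norm ((LINT x|lborel. v t x * k x) - (LINT x|lborel. v 0 x * k x))
          \<le> t powr (1 - 1 / p) * Xt_norm p q \<theta> T v * K"
        unfolding K_def using u(1) T
        by (intro X_space_pairing[OF p q \<theta>_def _ t(2) k(2)] vint t) (auto simp: Y_space_def v_def)
      also have "\<dots> \<le> t powr (1 - 1 / p) * \<bar>L\<bar> * K"
        using Xn[OF ball] K \<phi>(2) by (intro mult_right_mono mult_left_mono) (auto simp: v_def u_def)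
      also have "\<dots> \<le> 1 / 2 * K" using te K by (intro mult_right_mono) auto
      finally have 3: "norm ((LINT x|lborel. v t x * k x) - of_real K) \<le> K / 2" by (simp add: 2)
      have "K = norm (complex_of_real K)" using K by simp
      also have "\<dots> \<le> norm (LINT x|lborel. v t x * k x) + norm ((LINT x|lborel. v t x * k x) - of_real K)"
        by (metis norm_minus_commute norm_triangle_sub)
      finally have "K \<le> 2 * C * Lp_norm q (fourier F)" using 1 3 by simp
      then show ?thesis by (simp add: K_def k_def)
    qed
  qed
qed

section \<open>Unboundedness of the free evolution\<close>

lemma Lp_norm_gauss:
  assumes b: "Re b > 0" and r: "r > 0"
  shows "Lp_norm r (gauss b) = (pi / (r * Re b)) powr (1 / (2 * r))"
proof -
  have "norm (gauss b x) powr r = exp (- (r * Re b) * x\<^sup>2)" for x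
    by (simp add: norm_gauss exp_powr_real mult_ac)
  then have "Lp_norm r (gauss b) = sqrt (pi / (r * Re b)) powr (1 / r)"
    using gauss_integral_real[of "r * Re b"] b r by (simp add: Lp_norm_def has_bochner_integral_iff)
  also have "\<dots> = (pi / (r * Re b)) powr (1 / (2 * r))"
    using b r by (subst powr_half_sqrt[symmetric]) (simp_all add: powr_powr)
  finally show ?thesis .
qed

lemma Lp_norm_cmult:
  assumes "r > 0" shows "Lp_norm r (\<lambda>x. c * g x) = norm c * Lp_norm r g"
  using assms by (simp add: Lp_norm_def norm_mult powr_mult powr_powr)

text \<open>Only frequencies between a^(-1/2) and 2 a^(-1/2) are kept. There a(1+\<xi>^2) lies in
  [1, 5], which gives the factor 5^(-|\<sigma>|) a^(-\<sigma>), and 2a\<xi>^2 \<le> 8 gives exp(-8).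
  The interval has length a^(-1/2).\<close>

lemma bessel_gauss_integral_ge:
  fixes a \<sigma> :: real
  assumes a: "0 < a" "a \<le> 1"
  shows "5 powr (- \<bar>\<sigma>\<bar>) * exp (- 8) * a powr (- \<sigma> - 1 / 2)
    \<le> (LINT \<xi>|lborel. (1 + \<xi>\<^sup>2) powr \<sigma> * exp (- 2 * a * \<xi>\<^sup>2))"
proof -
  define r where "r = a powr (- 1 / 2)"
  have r: "r > 0" "r\<^sup>2 = 1 / a"
    using a by (auto simp: r_def powr_minus powr_half_sqrt field_simps)
  have "(\<lambda>\<xi>. norm (gauss_weight 1 \<sigma> (of_real (2 * a)) 0 \<xi>)) = (\<lambda>\<xi>. (1 + \<xi>\<^sup>2) powr \<sigma> * exp (- 2 * a * \<xi>\<^sup>2))"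
    by (auto simp: gauss_weight_def norm_mult simp flip: of_real_power of_real_mult)
  then have int: "integrable lborel (\<lambda>\<xi>. (1 + \<xi>\<^sup>2) powr \<sigma> * exp (- 2 * a * \<xi>\<^sup>2))"
    using integrable_norm[OF schwartz_integrable[OF gauss_weight_schwartz[of "of_real (2 * a)" 1 \<sigma> 0]]] a
    by simp
  have pt: "5 powr (- \<bar>\<sigma>\<bar>) * exp (- 8) * a powr (- \<sigma>) \<le> (1 + \<xi>\<^sup>2) powr \<sigma> * exp (- 2 * a * \<xi>\<^sup>2)"
    if \<xi>: "\<xi> \<in> {r..2 * r}" for \<xi>
  proof -
    have x: "1 / a \<le> \<xi>\<^sup>2" "\<xi>\<^sup>2 \<le> 4 / a"
      using power_mono[of r \<xi> 2] power_mono[of \<xi> "2 * r" 2] \<xi> r by (auto simp: power_mult_distrib)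
    define y where "y = a * (1 + \<xi>\<^sup>2)"
    have y: "1 \<le> y" "y \<le> 5" using x a by (auto simp: y_def field_simps)
    have "5 powr (- \<bar>\<sigma>\<bar>) \<le> y powr (- \<bar>\<sigma>\<bar>)" using y by (intro powr_mono2') auto
    also have "\<dots> \<le> y powr \<sigma>" using y by (intro powr_mono) auto
    finally have "5 powr (- \<bar>\<sigma>\<bar>) * a powr (- \<sigma>) \<le> y powr \<sigma> * a powr (- \<sigma>)" by (rule mult_right_mono) simp
    also have "\<dots> = (1 + \<xi>\<^sup>2) powr \<sigma>"
    proof -
      have "y powr \<sigma> = a powr \<sigma> * (1 + \<xi>\<^sup>2) powr \<sigma>"
        unfolding y_def by (rule powr_mult)
      then show ?thesis using a by (simp add: powr_minus)
    qed
    finally have "5 powr (- \<bar>\<sigma>\<bar>) * a powr (- \<sigma>) * exp (- 8) \<le> (1 + \<xi>\<^sup>2) powr \<sigma> * exp (- 2 * a * \<xi>\<^sup>2)"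
      using x a by (intro mult_mono) (auto simp: field_simps)
    then show ?thesis by (simp add: mult_ac)
  qed
  have "5 powr (- \<bar>\<sigma>\<bar>) * exp (- 8) * a powr (- \<sigma> - 1 / 2) = (5 powr (- \<bar>\<sigma>\<bar>) * exp (- 8) * a powr (- \<sigma>)) * r"
    by (simp add: r_def powr_add[symmetric] mult.assoc)
  also have "\<dots> = (LINT \<xi>|lborel. (5 powr (- \<bar>\<sigma>\<bar>) * exp (- 8) * a powr (- \<sigma>)) * indicator {r..2 * r} \<xi>)"
    using r by simp
  also have "\<dots> \<le> (LINT \<xi>|lborel. (1 + \<xi>\<^sup>2) powr \<sigma> * exp (- 2 * a * \<xi>\<^sup>2))"
  proof (rule integral_mono[OF _ int])
    show "integrable lborel (\<lambda>\<xi>. (5 powr (- \<bar>\<sigma>\<bar>) * exp (- 8) * a powr (- \<sigma>)) * indicator {r..2 * r} \<xi>)"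
      by (intro integrable_mult_right integrable_real_indicator) (auto simp: emeasure_lborel_Icc_eq)
    show "(5 powr (- \<bar>\<sigma>\<bar>) * exp (- 8) * a powr (- \<sigma>)) * indicator {r..2 * r} \<xi>
        \<le> (1 + \<xi>\<^sup>2) powr \<sigma> * exp (- 2 * a * \<xi>\<^sup>2)" for \<xi>
      using pt[of \<xi>] by (auto simp: indicator_def)
  qed
  finally show ?thesis .
qed

text \<open>The function \<open>gauss b\<close> in the proof, with \<open>1 / (4 * b) = a - \<i> * t\<close>, is the chirp that
  \<open>U(t)\<close> focuses to a Gaussian of width \<open>\<surd>a\<close>.\<close>
lemma smoothing_gauss_lower_bound:
  fixes a s t :: real
  assumes a: "0 < a" "a \<le> 1" and t: "t > 0"
    and pq: "p > 1" "q > 1" "1 / p + 1 / q = 1"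
  defines "G \<equiv> gauss_weight 1 (s / 2) (of_real a + \<i> * of_real t) 0"
  shows "sqrt (4 * pi * t) * (5 powr (- \<bar>s / 2\<bar>) * exp (- 8) * a powr (- s / 2 - 1 / 2))
    \<le> (4 * pi * (1 + t\<^sup>2) / p) powr (1 / (2 * p)) * a powr (- 1 / (2 * p)) * Lp_norm q (fourier G)"
proof -
  define z where "z = of_real a - \<i> * of_real t"
  define b where "b = 1 / (4 * z)"
  have z0: "z \<noteq> 0" using a by (auto simp: z_def complex_eq_iff)
  have Reb: "Re b = a / (4 * (a\<^sup>2 + t\<^sup>2))"
  proof -
    have "Re b = 4 * a / (16 * (a\<^sup>2 + t\<^sup>2))"
      by (simp add: b_def z_def Re_divide power2_eq_square algebra_simps)
    also have "\<dots> = (4 * a) / (4 * (4 * (a\<^sup>2 + t\<^sup>2)))" by simp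
    also have "\<dots> = a / (4 * (a\<^sup>2 + t\<^sup>2))" by (rule mult_divide_mult_cancel_left) simp
    finally show ?thesis .
  qed
  have b: "Re b > 0" using a unfolding Reb by (auto intro!: divide_pos_pos add_pos_nonneg)
  have G: "G \<in> schwartz" unfolding G_def by (rule gauss_weight_schwartz) (use a in simp)
  define \<kappa> where "\<kappa> = integral\<^sup>L lborel (gauss b)"
  \<comment> \<open>This keeps the constant \<kappa> of the transformed chirp away from 0 as a tends
    to 0.\<close>
  have "t \<le> norm z" using abs_Im_le_cmod[of z] t by (simp add: z_def)
  then have \<kappa>: "sqrt (4 * pi * t) \<le> norm \<kappa>"
  proof -
    have "norm b = 1 / (4 * norm z)" by (simp add: b_def norm_divide norm_mult)
    then have "norm \<kappa> = sqrt (4 * pi * norm z)"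
      using z0 by (simp add: \<kappa>_def norm_gauss_integral[OF b] mult_ac)
    then show ?thesis using \<open>t \<le> norm z\<close> by simp
  qed
  have "fourier (gauss b) \<xi> = \<kappa> * exp (- z * (of_real \<xi>)\<^sup>2)" for \<xi>
    unfolding fourier_gauss_aux[OF b] \<kappa>_def using z0 by (simp add: b_def mult.commute)
  \<comment> \<open>The parameters of \<open>G\<close> and of the transformed chirp are complex
    conjugates, so the oscillations cancel and the integrand is \<kappa> times a positive function:
    no cancellation is left in the pairing.\<close>
  then have "G \<xi> * fourier (gauss b) \<xi> = \<kappa> * of_real ((1 + \<xi>\<^sup>2) powr (s / 2) * exp (- 2 * a * \<xi>\<^sup>2))" for \<xi>
  proof -
    define c where "c = of_real a + \<i> * complex_of_real t"
    have R: "exp (- c * (of_real \<xi>)\<^sup>2) * exp (- z * (of_real \<xi>)\<^sup>2)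
        = complex_of_real (exp (- 2 * a * \<xi>\<^sup>2))"
      by (simp add: c_def z_def mult_exp_exp algebra_simps flip: exp_of_real)
    have "G \<xi> = of_real ((1 + \<xi>\<^sup>2) powr (s / 2)) * exp (- c * (of_real \<xi>)\<^sup>2)"
      by (simp add: G_def gauss_weight_def flip: c_def)
    then show ?thesis
      unfolding \<open>fourier (gauss b) \<xi> = _\<close> of_real_mult R[symmetric] by (simp only: mult_ac)
  qed
  then have "(LINT \<xi>|lborel. G \<xi> * fourier (gauss b) \<xi>)
      = \<kappa> * of_real (LINT \<xi>|lborel. (1 + \<xi>\<^sup>2) powr (s / 2) * exp (- 2 * a * \<xi>\<^sup>2))"
    by (simp only: integral_mult_right_zero integral_complex_of_real)
  moreover have "(LINT x|lborel. fourier G x * gauss b x) = (LINT \<xi>|lborel. G \<xi> * fourier (gauss b) \<xi>)"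
    by (intro fourier_mult_formula schwartz_integrable G gauss_schwartz b)
  ultimately have "norm \<kappa> * (LINT \<xi>|lborel. (1 + \<xi>\<^sup>2) powr (s / 2) * exp (- 2 * a * \<xi>\<^sup>2))
      = norm (LINT x|lborel. gauss b x * fourier G x)"
    by (simp add: norm_mult mult.commute)
  also have "\<dots> \<le> Lp_norm p (gauss b) * Lp_norm q (fourier G)"
    using pq by (intro Lp_pairing(3) pq schwartz_Lp fourier_schwartz G gauss_schwartz b) auto
  \<comment> \<open>Re b = a/(4(a^2+t^2)) is of order a for fixed t; bounding a^2 by 1 isolates the
    power of a.\<close>
  also have "Lp_norm p (gauss b) \<le> (4 * pi * (1 + t\<^sup>2) / p) powr (1 / (2 * p)) * a powr (- 1 / (2 * p))"
  proof -
    have "pi / (p * Re b) = 4 * pi * (a\<^sup>2 + t\<^sup>2) / p / a" using a by (simp add: Reb field_simps)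
    also have "\<dots> \<le> 4 * pi * (1 + t\<^sup>2) / p / a"
      using a pq power_le_one[of a 2] by (intro divide_right_mono mult_left_mono add_mono) auto
    finally have "(pi / (p * Re b)) powr (1 / (2 * p)) \<le> (4 * pi * (1 + t\<^sup>2) / p / a) powr (1 / (2 * p))"
      using b pq by (intro powr_mono2) auto
    also have "\<dots> = (4 * pi * (1 + t\<^sup>2) / p) powr (1 / (2 * p)) * a powr (- 1 / (2 * p))"
      using a pq by (subst powr_divide) (auto simp: powr_minus field_simps)
    finally show ?thesis using Lp_norm_gauss[OF b, of p] pq by simp
  qed
  finally have *: "norm \<kappa> * (LINT \<xi>|lborel. (1 + \<xi>\<^sup>2) powr (s / 2) * exp (- 2 * a * \<xi>\<^sup>2))
    \<le> (4 * pi * (1 + t\<^sup>2) / p) powr (1 / (2 * p)) * a powr (- 1 / (2 * p)) * Lp_norm q (fourier G)"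
    by (simp add: mult_right_mono)
  have "sqrt (4 * pi * t) * (5 powr (- \<bar>s / 2\<bar>) * exp (- 8) * a powr (- (s / 2) - 1 / 2))
    \<le> norm \<kappa> * (LINT \<xi>|lborel. (1 + \<xi>\<^sup>2) powr (s / 2) * exp (- 2 * a * \<xi>\<^sup>2))"
    by (intro mult_mono \<kappa> bessel_gauss_integral_ge a) auto
  with * show ?thesis by simp
qed

text \<open>For Gaussians of parameter a the lower bound has the power -s/2 - 1/2 and the upper
  bound, by 1/q = 1 - 1/p, the power -1/p. The gap \<delta> = (s+1-2/p)/2 is positive by the
  hypothesis on s, so a tending to 0 contradicts any constant.\<close>

lemma smoothing_bound_false:
  fixes p s t C :: real
  assumes p: "p > 2" and q: "q = p / (p - 1)" and s: "s > - (1 - 2 / p)" and t: "t > 0"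
    and bound: "\<And>F G. F \<in> schwartz \<Longrightarrow>
      (\<lambda>\<xi>. of_real ((1 + \<xi>\<^sup>2) powr (s / 2)) * F \<xi>) \<in> schwartz \<Longrightarrow>
      G = (\<lambda>\<xi>. exp (- \<i> * of_real (t * \<xi>\<^sup>2)) * (of_real ((1 + \<xi>\<^sup>2) powr (s / 2)) * F \<xi>)) \<Longrightarrow>
      G \<in> schwartz \<Longrightarrow> Lp_norm q (fourier G) \<le> C * Lp_norm q (fourier F)"
  shows False
proof -
  have pq: "p > 1" "q > 1" "1 / p + 1 / q = 1" unfolding q using p by (auto simp: field_simps)
  define c1 where "c1 = sqrt (4 * pi * t) * (5 powr (- \<bar>s / 2\<bar>) * exp (- 8))"
  define D where "D = (4 * pi * (1 + t\<^sup>2) / p) powr (1 / (2 * p))"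
  define c2 where "c2 = D * (\<bar>C\<bar> * sqrt pi * (4 * pi / q) powr (1 / (2 * q)))"
  define \<delta> where "\<delta> = (s + 1 - 2 / p) / 2"
  have \<delta>: "\<delta> > 0" using s by (simp add: \<delta>_def)
  have c: "c1 > 0" "c2 \<ge> 0" "D \<ge> 0" using t by (auto simp: c1_def c2_def D_def)
  have main: "c1 * a powr (- \<delta>) \<le> c2" if a: "0 < a" "a \<le> 1" for a
  proof -
    define F where "F = gauss (of_real a)"
    define G where "G = gauss_weight 1 (s / 2) (of_real a + \<i> * of_real t) 0"
    have F: "F \<in> schwartz" unfolding F_def by (rule gauss_schwartz) (use a in simp)
    have "(\<lambda>\<xi>. of_real ((1 + \<xi>\<^sup>2) powr (s / 2)) * F \<xi>) = gauss_weight 1 (s / 2) (of_real a) 0"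
      by (auto simp: F_def gauss_def gauss_weight_def)
    then have mF: "(\<lambda>\<xi>. of_real ((1 + \<xi>\<^sup>2) powr (s / 2)) * F \<xi>) \<in> schwartz"
      using gauss_weight_schwartz[of "of_real a" 1 "s / 2" 0] a by simp
    have G: "G \<in> schwartz" unfolding G_def by (rule gauss_weight_schwartz) (use a in simp)
    have G_eq: "G = (\<lambda>\<xi>. exp (- \<i> * of_real (t * \<xi>\<^sup>2)) * (of_real ((1 + \<xi>\<^sup>2) powr (s / 2)) * F \<xi>))"
    proof
      fix \<xi>
      define c where "c = of_real a + \<i> * complex_of_real t"
      have "exp (- c * (of_real \<xi>)\<^sup>2)
          = exp (- \<i> * of_real (t * \<xi>\<^sup>2)) * exp (- of_real a * (complex_of_real \<xi>)\<^sup>2)"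
        by (simp add: c_def mult_exp_exp algebra_simps)
      moreover have "G \<xi> = of_real ((1 + \<xi>\<^sup>2) powr (s / 2)) * exp (- c * (of_real \<xi>)\<^sup>2)"
        by (simp add: G_def gauss_weight_def flip: c_def)
      ultimately show "G \<xi> = exp (- \<i> * of_real (t * \<xi>\<^sup>2)) * (of_real ((1 + \<xi>\<^sup>2) powr (s / 2)) * F \<xi>)"
        unfolding F_def gauss_def by (simp only: mult.left_commute)
    qed
    have "fourier F = (\<lambda>x. of_real (sqrt (pi / a)) * gauss (of_real (1 / (4 * a))) x)"
      using a by (auto simp: F_def fun_eq_iff fourier_gauss_aux gauss_integral_of_real gauss_def)
    then have "Lp_norm q (fourier F) = sqrt (pi / a) * (pi / (q * (1 / (4 * a)))) powr (1 / (2 * q))"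
      using a pq Lp_norm_gauss[of "of_real (1 / (4 * a))" q] by (simp add: Lp_norm_cmult)
    also have "sqrt (pi / a) = sqrt pi * a powr (- 1 / 2)"
      using a by (simp add: real_sqrt_divide powr_minus powr_half_sqrt field_simps)
    also have "(pi / (q * (1 / (4 * a)))) = (4 * pi / q) * a" by simp
    also have "((4 * pi / q) * a) powr (1 / (2 * q)) = (4 * pi / q) powr (1 / (2 * q)) * a powr (1 / (2 * q))"
      using a pq by (subst powr_mult) auto
    finally have nF: "Lp_norm q (fourier F)
        = sqrt pi * a powr (- 1 / 2) * ((4 * pi / q) powr (1 / (2 * q)) * a powr (1 / (2 * q)))" .
    have "Lp_norm q (fourier G) \<le> \<bar>C\<bar> * Lp_norm q (fourier F)"
      by (rule order_trans[OF bound[OF F mF G_eq G]]) (intro mult_right_mono, auto)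
    then have "D * a powr (- 1 / (2 * p)) * Lp_norm q (fourier G)
        \<le> D * a powr (- 1 / (2 * p)) * (\<bar>C\<bar> * Lp_norm q (fourier F))"
      using c by (intro mult_left_mono) auto
    also have "\<dots> = c2 * (a powr (- 1 / (2 * p)) * (a powr (- 1 / 2) * a powr (1 / (2 * q))))"
      by (simp add: nF c2_def)
    also have "a powr (- 1 / (2 * p)) * (a powr (- 1 / 2) * a powr (1 / (2 * q)))
        = a powr (- 1 / (2 * p) + (- 1 / 2 + 1 / (2 * q)))"
      by (simp only: powr_add)
    finally have "D * a powr (- 1 / (2 * p)) * Lp_norm q (fourier G)
        \<le> c2 * a powr (- 1 / (2 * p) + (- 1 / 2 + 1 / (2 * q)))" .
    with smoothing_gauss_lower_bound[OF a t pq, of s]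
    have "c1 * a powr (- s / 2 - 1 / 2) \<le> c2 * a powr (- 1 / (2 * p) + (- 1 / 2 + 1 / (2 * q)))"
      by (simp add: c1_def D_def G_def mult.assoc)
    then have "c1 * a powr (- s / 2 - 1 / 2) * a powr (1 / (2 * p) + (1 / 2 - 1 / (2 * q)))
        \<le> c2 * a powr (- 1 / (2 * p) + (- 1 / 2 + 1 / (2 * q))) * a powr (1 / (2 * p) + (1 / 2 - 1 / (2 * q)))"
      by (rule mult_right_mono) simp
    moreover have "1 / q = 1 - 1 / p" using pq by simp
    then have "- s / 2 - 1 / 2 + (1 / (2 * p) + (1 / 2 - 1 / (2 * q))) = - \<delta>"
      by (simp add: \<delta>_def field_simps)
    ultimately show ?thesis
      using a by (simp only: mult.assoc powr_add[symmetric]) simp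
  qed
  \<comment> \<open>Solves c1 a^(-\<delta>) = c1 + c2, which exceeds c2; the base is at least 1, so
    a \<le> 1.\<close>
  define a where "a = (c2 / c1 + 1) powr (- 1 / \<delta>)"
  have c21: "c2 / c1 + 1 \<ge> 1" using c by simp
  then have a: "0 < a" by (simp add: a_def)
  have "a \<le> (c2 / c1 + 1) powr 0" unfolding a_def using c21 \<delta> by (intro powr_mono) auto
  then have a1: "a \<le> 1" using c21 by simp
  have "a powr (- \<delta>) = c2 / c1 + 1" using \<delta> c21 by (simp add: a_def powr_powr)
  then have "c1 * a powr (- \<delta>) = c2 + c1" using c by (simp add: distrib_left)
  with main[OF a a1] c show False by linarith
qed

theorem corollary1p6:
  fixes p s :: real
    and T :: "real \<Rightarrow> real"
    and S :: "real \<Rightarrow> (real \<Rightarrow> complex) \<Rightarrow> real \<Rightarrow> distr"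
  assumes "2 < p" and "p \<le> 3" and "s > - (1 - 2 / p)"
    and "\<And>M. M > 0 \<Longrightarrow> lwp_solution_map p M (T M) (S M)"
  shows "\<not> (\<forall>M>0.
      (\<forall>\<phi>\<in>Lp_ball p M. S M \<phi> \<in> bessel_continuous s p (T M)) \<and>
      (\<exists>C>0. \<forall>\<phi>1\<in>Lp_ball p M. \<forall>\<phi>2\<in>Lp_ball p M.
         (SUP t\<in>{0..T M}. ennreal (bessel_norm s p (distr_diff (S M \<phi>1 t) (S M \<phi>2 t))))
           \<le> ennreal (C * Lp_norm p (\<lambda>x. \<phi>1 x - \<phi>2 x))))"
proof
  assume "\<forall>M>0.
      (\<forall>\<phi>\<in>Lp_ball p M. S M \<phi> \<in> bessel_continuous s p (T M)) \<and>
      (\<exists>C>0. \<forall>\<phi>1\<in>Lp_ball p M. \<forall>\<phi>2\<in>Lp_ball p M.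
         (SUP t\<in>{0..T M}. ennreal (bessel_norm s p (distr_diff (S M \<phi>1 t) (S M \<phi>2 t))))
           \<le> ennreal (C * Lp_norm p (\<lambda>x. \<phi>1 x - \<phi>2 x)))"
  \<comment> \<open>The dual data have norm 1, so the assertion already fails in the unit
    ball.\<close>
  from mp[OF spec[OF this] zero_less_one]
  have cont: "\<forall>\<phi>\<in>Lp_ball p 1. S 1 \<phi> \<in> bessel_continuous s p (T 1)"
    and "\<exists>C>0. \<forall>\<phi>1\<in>Lp_ball p 1. \<forall>\<phi>2\<in>Lp_ball p 1.
      (SUP t\<in>{0..T 1}. ennreal (bessel_norm s p (distr_diff (S 1 \<phi>1 t) (S 1 \<phi>2 t))))
        \<le> ennreal (C * Lp_norm p (\<lambda>x. \<phi>1 x - \<phi>2 x))"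
    by (rule conjunct1, rule conjunct2)
  then obtain C where C: "C > 0" and lip: "\<forall>\<phi>1\<in>Lp_ball p 1. \<forall>\<phi>2\<in>Lp_ball p 1.
      (SUP t\<in>{0..T 1}. ennreal (bessel_norm s p (distr_diff (S 1 \<phi>1 t) (S 1 \<phi>2 t))))
        \<le> ennreal (C * Lp_norm p (\<lambda>x. \<phi>1 x - \<phi>2 x))"
    by (elim exE conjE)
  define q where "q = p / (p - 1)"
  obtain t where t: "t > 0" and bound: "\<forall>F G. F \<in> schwartz \<longrightarrow>
    (\<lambda>\<xi>. of_real ((1 + \<xi>\<^sup>2) powr (s / 2)) * F \<xi>) \<in> schwartz \<longrightarrow>
    G = (\<lambda>\<xi>. exp (- \<i> * of_real (t * \<xi>\<^sup>2)) * (of_real ((1 + \<xi>\<^sup>2) powr (s / 2)) * F \<xi>)) \<longrightarrow>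
    G \<in> schwartz \<longrightarrow> Lp_norm q (fourier G) \<le> 2 * C * Lp_norm q (fourier F)"
    using smoothing_bound[OF assms(1) q_def assms(4)[OF zero_less_one] order_refl cont C lip] by (elim exE conjE)
  show False
    by (rule smoothing_bound_false[OF assms(1) q_def assms(3) t, of "2 * C"]) (use bound in blast)
qed

end
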